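(* There exists a removable spectrum $\{t_n\}$ such that $\{t_n\}_{n\neq m}$ is nonremovable (i.e. not removable) for any $m$.
   Context: Removable spectra. Let $\{t_n\}$ be an infinite sequence of pairwise distinct nonzero real numbers with $|t_n|\to\infty$, let $\mu=\sum_n\mu_n\delta_{t_n}$ with masses $\mu_n>0$, and let $\mathcal{A}$ be the selfadjoint operator of multiplication by the independent variable $x$ in $L^2(\mu)$ with its natural domain $\mathcal{D}(\mathcal{A})=\{f\in L^2(\mu): xf\in L^2(\mu)\}$; $\mathcal{A}^{-1}$ is bounded. Let $a,b$ be functions with $a/x,\ b/x\in L^2(\mu)$ (possibly $a,b\notin L^2(\mu)$) and let $\varkappa\in\mathbb{C}$ be such that $\varkappa\neq\int_{\mathbb{R}}x^{-1}a(x)\overline{b(x)}\,d\mu(x)$ in the case when $a\in L^2(\mu)$ (no condition on $\varkappa$ if $a\notin L^2(\mu)$). The singular rank one perturbation $\mathcal{L}=\mathcal{L}(\mathcal{A},a,b,\varkappa)$ of $\mathcal{A}$ is the operator in $L^2(\mu)$ defined by $$\mathcal{D}(\mathcal{L})=\{y=y_0+c\cdot\mathcal{A}^{-1}a:\ c\in\mathbb{C},\ y_0\in\mathcal{D}(\mathcal{A}),\ \varkappa c+\langle y_0,b\rangle=0\},\qquad \mathcal{L}y=\mathcal{A}y_0,$$ where $\mathcal{A}^{-1}a$ denotes the function $a/x$ and $\langle y_0,b\rangle=\int y_0\overline{b}\,d\mu$. (The condition on $\varkappa$ makes the decomposition of $y$ unique.) The spectrum $\{t_n\}$ is called removable if there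 exists a singular rank one perturbation $\mathcal{L}(\mathcal{A},a,b,\varkappa)$ of $\mathcal{A}$ whose spectrum is empty. This property does not depend on the choice of the masses $\mu_n>0$. *)

theory Defs
  imports "HOL-Analysis.Analysis"
begin

section \<open>The space $L^2(\mu)$\<close>

text \<open>
  Elements of $L^2(\mu)$ are represented by functions; equality in $L^2(\mu)$ is
  equality almost everywhere.  Linear operators are represented by their graphs.
\<close>

definition L2 :: "'a measure \<Rightarrow> ('a \<Rightarrow> complex) set" where
  "L2 M = {f \<in> borel_measurable M. integrable M (\<lambda>x. (cmod (f x))\<^sup>2)}"

definition L2_norm :: "'a measure \<Rightarrow> ('a \<Rightarrow> complex) \<Rightarrow> real" where
  "L2_norm M f = sqrt (\<integral>x. (cmod (f x))\<^sup>2 \<partial>M)"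

definition L2_pairing :: "'a measure \<Rightarrow> ('a \<Rightarrow> complex) \<Rightarrow> ('a \<Rightarrow> complex) \<Rightarrow> complex" where
  "L2_pairing M f g = (\<integral>x. f x * cnj (g x) \<partial>M)"

type_synonym 'a operator_graph = "(('a \<Rightarrow> complex) \<times> ('a \<Rightarrow> complex)) set"

text \<open>
  A number z belongs to the resolvent set of an operator T if T - z is a bijection
  from the domain of T onto the whole space with bounded inverse.
\<close>

definition resolvent_set :: "'a measure \<Rightarrow> 'a operator_graph \<Rightarrow> complex set" where
  "resolvent_set M T = {z.
     (\<forall>(y, v) \<in> T. (AE x in M. v x - z * y x = 0) \<longrightarrow> (AE x in M. y x = 0)) \<and>
     (\<forall>g \<in> L2 M. \<exists>(y, v) \<in> T. AE x in M. v x - z * y x = g x) \<and>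
     (\<exists>C. \<forall>(y, v) \<in> T. L2_norm M y \<le> C * L2_norm M (\<lambda>x. v x - z * y x))}"

definition op_spectrum :: "'a measure \<Rightarrow> 'a operator_graph \<Rightarrow> complex set" where
  "op_spectrum M T = - resolvent_set M T"


section \<open>Singular rank one perturbations of the multiplication operator\<close>

definition mult_domain :: "real measure \<Rightarrow> (real \<Rightarrow> complex) set" where
  "mult_domain M = {f \<in> L2 M. (\<lambda>x. of_real x * f x) \<in> L2 M}"

definition admissible_data ::
  "real measure \<Rightarrow> (real \<Rightarrow> complex) \<Rightarrow> (real \<Rightarrow> complex) \<Rightarrow> complex \<Rightarrow> bool" where
  "admissible_data M a b \<kappa> \<longleftrightarrow>
     a \<in> borel_measurable M \<and> b \<in> borel_measurable M \<and>
     (\<lambda>x. a x / of_real x) \<in> L2 M \<and> (\<lambda>x. b x / of_real x) \<in> L2 M \<and>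
     (a \<in> L2 M \<longrightarrow> \<kappa> \<noteq> (\<integral>x. inverse (of_real x) * a x * cnj (b x) \<partial>M))"

definition rank_one_perturbation ::
  "real measure \<Rightarrow> (real \<Rightarrow> complex) \<Rightarrow> (real \<Rightarrow> complex) \<Rightarrow> complex \<Rightarrow> real operator_graph" where
  "rank_one_perturbation M a b \<kappa> = {(y, v). y \<in> L2 M \<and> v \<in> L2 M \<and>
     (\<exists>y0 \<in> mult_domain M. \<exists>c.
        \<kappa> * c + L2_pairing M y0 b = 0 \<and>
        (AE x in M. y x = y0 x + c * (a x / of_real x)) \<and>
        (AE x in M. v x = of_real x * y0 x))}"


section \<open>Removable spectra\<close>

definition spectral_sequence :: "(nat \<Rightarrow> real) \<Rightarrow> bool" where
  "spectral_sequence t \<longleftrightarrow>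
     inj t \<and> (\<forall>n. t n \<noteq> 0) \<and> filterlim (\<lambda>n. \<bar>t n\<bar>) at_top sequentially"

text \<open>
  The Borel measure with mass w n at each point t n: the image under t of the
  measure on the index set that gives mass w n to n.
\<close>

definition atomic_measure :: "(nat \<Rightarrow> real) \<Rightarrow> (nat \<Rightarrow> real) \<Rightarrow> real measure" where
  "atomic_measure t w = distr (point_measure UNIV (\<lambda>n. ennreal (w n))) borel t"

lemma emeasure_atomic_measure:
  assumes "A \<in> sets borel"
  shows "emeasure (atomic_measure t w) A = (\<Sum>n. ennreal (w n) * indicator A (t n))"
proof -
  have "emeasure (atomic_measure t w) A =
      (\<integral>\<^sup>+ n. ennreal (w n) * indicator (t -` A) n \<partial>count_space UNIV)"
    using assms unfolding atomic_measure_def point_measure_def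
    by (subst emeasure_distr) (auto simp: emeasure_density)
  then show ?thesis
    by (simp add: nn_integral_count_space_nat indicator_vimage)
qed

definition removable :: "(nat \<Rightarrow> real) \<Rightarrow> (nat \<Rightarrow> real) \<Rightarrow> bool" where
  "removable t w \<longleftrightarrow>
     (\<exists>a b \<kappa>. admissible_data (atomic_measure t w) a b \<kappa> \<and>
        op_spectrum (atomic_measure t w)
          (rank_one_perturbation (atomic_measure t w) a b \<kappa>) = {})"

text \<open>The sequence t with the term of index m deleted, reindexed by the natural numbers.\<close>

definition omit_term :: "nat \<Rightarrow> (nat \<Rightarrow> real) \<Rightarrow> nat \<Rightarrow> real" where
  "omit_term m t = (\<lambda>n. if n < m then t n else t (Suc n))"

end

theory Submission
  imports Defs "HOL-Real_Asymp.Real_Asymp" "HOL-Complex_Analysis.Complex_Analysis"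
begin

text \<open>
  In the coordinates sqrt(w n) * f(t n), the space over the atomic measure becomes the space of
  square summable sequences, whatever the masses are, and the perturbation is governed by the
  numbers c n = \<alpha> n * cnj (\<beta> n), where \<alpha> and \<beta> are the coordinates of a and b.  Solving
  (L - z) y = g coordinate by coordinate leaves one linear equation for the free constant that
  parametrizes the domain; if z is none of the t n, its coefficient is
  \<Phi> z = \<kappa> + (\<Sum>n. c n * z / (t n * (t n - z))).
  Hence the spectrum of L is empty iff no c n vanishes and \<Phi> has no zeros off the t n
  (\<open>rank_one_data.spectrum_empty_iff\<close>).  Then 1 / \<Phi> is an entire function with simple zeros exactly
  at the t n, and removability becomes a question on such functions, subject to
  the summability of |c n| / (t n)^2 that comes from a/x and b/x being square integrable.

  The witness is the sequence of squares 1, 4, 9, ..., the zero set of the entire function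
  F(z) = sin(\<pi> sqrt z) / (\<pi> sqrt z).  The derivative of F at n^2 has modulus 1 / (2 n^2), so 1 / F
  has residues of modulus 2 n^2, just small enough for \<Sum> n^2 / n^4 to converge; the partial fraction
  expansion of 1 / sin shows that 1 / F is indeed of the form \<Phi> (\<open>sin_partial_fractions\<close>,
  \<open>squares_removable\<close>).

  Deleting the square T = (m+1)^2 replaces F by G(z) = F(z) / (z - T) and makes the residues of the reciprocal
  grow like n^4, which is too fast.  To exclude every other choice of c and \<kappa>, suppose that \<Phi>
  arises from the deleted sequence and has no zeros.  Then H = G * \<Phi> extends to an entire function without zeros
  (\<open>entire_multiple_of_coupling_function\<close>), and on the circles |z| = (j + 1/2)^2 its logarithm is
  O(j), which is o(|z|); an entire function of this kind is constant
  (\<open>zero_free_entire_small_growth_constant\<close>).  Therefore the numbers c n are a nonzero constant multiple of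
  the reciprocals of the derivatives of G at the remaining squares s n, the quotients |c n| / (s n)^2 stay away from 0,
  and their sum diverges.
\<close>

section \<open>Coordinates in the space over an atomic measure\<close>

text \<open>
  Every point t n is an atom, and the complement of the countable set of atoms is a null set.
\<close>
lemma AE_atomic_measure_iff:
  assumes "\<And>n. w n > 0"
  shows "(AE x in atomic_measure t w. P x) \<longleftrightarrow> (\<forall>n. P (t n))"
proof
  assume "AE x in atomic_measure t w. P x"
  then obtain N where N: "N \<in> sets borel" "emeasure (atomic_measure t w) N = 0" "{x. \<not> P x} \<subseteq> N"
    by (auto elim!: AE_E simp: atomic_measure_def)
  show "\<forall>n. P (t n)"
  proof (rule allI, rule ccontr)
    fix n assume "\<not> P (t n)"
    then have "t n \<in> N" using N by auto
    have "(\<Sum>n. ennreal (w n) * indicator N (t n)) = 0"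
      using N emeasure_atomic_measure by metis
    then have "ennreal (w n) * indicator N (t n) = 0"
      using suminf_eq_zero_iff[of "\<lambda>n. ennreal (w n) * indicator N (t n)"] by (metis summableI zero_le)
    then show False using \<open>t n \<in> N\<close> assms[of n] by simp
  qed
next
  assume P: "\<forall>n. P (t n)"
  have "range t \<in> sets borel"
    by (rule sets.countable) auto
  then have "- range t \<in> null_sets (atomic_measure t w)"
    by (auto simp: null_sets_def emeasure_atomic_measure) (auto simp: atomic_measure_def)
  then show "AE x in atomic_measure t w. P x"
    by (rule AE_I') (use P in auto)
qed

lemma integrable_atomic_measure_iff:
  fixes f :: "real \<Rightarrow> 'b::{banach,second_countable_topology}"
  assumes "\<And>n. w n > 0" "f \<in> borel_measurable borel"
  shows "integrable (atomic_measure t w) f \<longleftrightarrow> summable (\<lambda>n. w n * norm (f (t n)))"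
  unfolding atomic_measure_def point_measure_def using assms
  by (subst integrable_distr_eq)
     (auto simp: integrable_density integrable_count_space_nat_iff less_imp_le)

lemma integral_atomic_measure:
  fixes f :: "real \<Rightarrow> 'b::{banach,second_countable_topology}"
  assumes "\<And>n. w n > 0" "f \<in> borel_measurable borel" "summable (\<lambda>n. w n * norm (f (t n)))"
  shows "(\<integral>x. f x \<partial>atomic_measure t w) = (\<Sum>n. w n *\<^sub>R f (t n))"
  unfolding atomic_measure_def point_measure_def using assms
  by (subst integral_distr)
     (auto simp: integral_density integral_count_space_nat integrable_count_space_nat_iff less_imp_le)

definition square_summable :: "(nat \<Rightarrow> complex) \<Rightarrow> bool" where
  "square_summable u \<longleftrightarrow> summable (\<lambda>n. (cmod (u n))\<^sup>2)"

text \<open>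
  The factor sqrt (w n) absorbs the masses: norms and pairings below take the same form for
  every w.
\<close>
definition atomic_coeff :: "(nat \<Rightarrow> real) \<Rightarrow> (nat \<Rightarrow> real) \<Rightarrow> (real \<Rightarrow> complex) \<Rightarrow> nat \<Rightarrow> complex" where
  "atomic_coeff t w f n = of_real (sqrt (w n)) * f (t n)"

lemma cmod_atomic_coeff_sq:
  "w n > 0 \<Longrightarrow> (cmod (atomic_coeff t w f n))\<^sup>2 = w n * (cmod (f (t n)))\<^sup>2"
  by (simp add: atomic_coeff_def norm_mult power_mult_distrib)

lemma borel_measurable_atomic: "borel_measurable (atomic_measure t w) = borel_measurable borel"
  unfolding atomic_measure_def by (rule measurable_cong_sets) auto

lemma L2_atomic_iff:
  assumes "\<And>n. w n > 0"
  shows "f \<in> L2 (atomic_measure t w) \<longleftrightarrow>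
    f \<in> borel_measurable borel \<and> square_summable (atomic_coeff t w f)"
  using integrable_atomic_measure_iff[of w "\<lambda>x. (cmod (f x))\<^sup>2" t] assms
  by (auto simp: L2_def borel_measurable_atomic square_summable_def cmod_atomic_coeff_sq assms)

lemma L2_norm_atomic:
  assumes "\<And>n. w n > 0" "f \<in> L2 (atomic_measure t w)"
  shows "L2_norm (atomic_measure t w) f = sqrt (\<Sum>n. (cmod (atomic_coeff t w f n))\<^sup>2)"
proof -
  have f: "f \<in> borel_measurable borel" "square_summable (atomic_coeff t w f)"
    using assms L2_atomic_iff by blast+
  then show ?thesis
    using integral_atomic_measure[of w "\<lambda>x. (cmod (f x))\<^sup>2" t]
    by (simp add: L2_norm_def square_summable_def cmod_atomic_coeff_sq assms)
qed

lemma L2_pairing_atomic: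
  assumes "\<And>n. w n > 0" "f \<in> borel_measurable borel" "g \<in> borel_measurable borel"
    and "summable (\<lambda>n. cmod (atomic_coeff t w f n * cnj (atomic_coeff t w g n)))"
  shows "L2_pairing (atomic_measure t w) f g =
    (\<Sum>n. atomic_coeff t w f n * cnj (atomic_coeff t w g n))"
proof -
  have *: "atomic_coeff t w f n * cnj (atomic_coeff t w g n) = w n *\<^sub>R (f (t n) * cnj (g (t n)))" for n
    using assms(1)[of n] by (simp add: atomic_coeff_def scaleR_conv_of_real flip: of_real_mult)
  have "summable (\<lambda>n. w n * cmod (f (t n) * cnj (g (t n))))"
    using assms(4) assms(1) unfolding * by (simp add: less_imp_le)
  moreover have "(\<lambda>x. cnj (g x)) \<in> borel_measurable borel"
    using assms(3) by (rule measurable_compose) (intro borel_measurable_continuous_onI continuous_intros)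
  ultimately show ?thesis unfolding L2_pairing_def *
    by (intro integral_atomic_measure) (use assms in auto)
qed

text \<open>
  The representative with prescribed coordinates that vanishes off the atoms; it is measurable
  because its support is countable.
\<close>
definition atomic_function :: "(nat \<Rightarrow> real) \<Rightarrow> (nat \<Rightarrow> real) \<Rightarrow> (nat \<Rightarrow> complex) \<Rightarrow> real \<Rightarrow> complex" where
  "atomic_function t w u x =
    (if x \<in> range t then u (inv t x) / of_real (sqrt (w (inv t x))) else 0)"

lemma atomic_function_measurable: "atomic_function t w u \<in> borel_measurable borel"
  by (rule measurable_discrete_difference[of "\<lambda>x. 0" borel borel "range t"])
     (auto simp: atomic_function_def)

lemma atomic_function_at: "inj t \<Longrightarrow> atomic_function t w u (t n) = u n / of_real (sqrt (w n))"
  by (simp add: atomic_function_def)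

lemma atomic_coeff_atomic_function:
  assumes "\<And>n. w n > 0" "inj t"
  shows "atomic_coeff t w (atomic_function t w u) = u"
proof
  fix n show "atomic_coeff t w (atomic_function t w u) n = u n"
    using assms(1)[of n] by (simp add: atomic_coeff_def atomic_function_at assms(2))
qed

section \<open>Square summable sequences\<close>

lemma square_summable_cmult:
  "square_summable u \<Longrightarrow> square_summable (\<lambda>n. k * u n)"
  by (simp add: square_summable_def norm_mult power_mult_distrib summable_mult)

lemma square_summable_bounded_mult:
  assumes "square_summable u" "\<And>n. cmod (d n) \<le> K"
  shows "square_summable (\<lambda>n. d n * u n)"
  unfolding square_summable_def
proof (rule summable_comparison_test)
  show "\<exists>N. \<forall>n\<ge>N. norm ((cmod (d n * u n))\<^sup>2) \<le> K\<^sup>2 * (cmod (u n))\<^sup>2"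
    using assms(2) by (auto simp: norm_mult power_mult_distrib intro!: mult_right_mono power_mono)
  show "summable (\<lambda>n. K\<^sup>2 * (cmod (u n))\<^sup>2)"
    using assms(1) by (simp add: square_summable_def summable_mult)
qed

lemma cmod_add_sq_le: "(cmod (x + y))\<^sup>2 \<le> 2 * (cmod x)\<^sup>2 + 2 * (cmod y)\<^sup>2"
proof -
  have "(cmod (x + y))\<^sup>2 \<le> (cmod x + cmod y)\<^sup>2"
    by (intro power_mono norm_triangle_ineq) auto
  also have "\<dots> \<le> 2 * (cmod x)\<^sup>2 + 2 * (cmod y)\<^sup>2"
    using sum_squares_bound[of "cmod x" "cmod y"] by (simp add: power2_sum)
  finally show ?thesis .
qed

lemma square_summable_add:
  assumes "square_summable u" "square_summable v"
  shows "square_summable (\<lambda>n. u n + v n)"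
  unfolding square_summable_def
proof (rule summable_comparison_test)
  show "\<exists>N. \<forall>n\<ge>N. norm ((cmod (u n + v n))\<^sup>2) \<le> 2 * (cmod (u n))\<^sup>2 + 2 * (cmod (v n))\<^sup>2"
    using cmod_add_sq_le by auto
  show "summable (\<lambda>n. 2 * (cmod (u n))\<^sup>2 + 2 * (cmod (v n))\<^sup>2)"
    using assms by (auto simp: square_summable_def intro!: summable_add summable_mult)
qed

lemma square_summable_delta: "square_summable (\<lambda>n. if n = k then x else 0)"
  unfolding square_summable_def
  by (rule summable_finite[of "{k}"]) auto

lemma summable_mult_square_summable:
  assumes "square_summable u" "square_summable v"
  shows "summable (\<lambda>n. cmod (u n * cnj (v n)))"
proof (rule summable_comparison_test)
  show "\<exists>N. \<forall>n\<ge>N. norm (cmod (u n * cnj (v n))) \<le> (cmod (u n))\<^sup>2 + (cmod (v n))\<^sup>2"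
  proof (intro exI[of _ 0] allI impI)
    fix n
    have "0 \<le> cmod (u n) * cmod (v n)" by simp
    then have "cmod (u n) * cmod (v n) \<le> (cmod (u n))\<^sup>2 + (cmod (v n))\<^sup>2"
      using sum_squares_bound[of "cmod (u n)" "cmod (v n)"] by linarith
    then show "norm (cmod (u n * cnj (v n))) \<le> (cmod (u n))\<^sup>2 + (cmod (v n))\<^sup>2"
      by (simp add: norm_mult)
  qed
  show "summable (\<lambda>n. (cmod (u n))\<^sup>2 + (cmod (v n))\<^sup>2)"
    using assms by (auto simp: square_summable_def intro!: summable_add)
qed

lemma Cauchy_Schwarz_suminf:
  assumes "square_summable u" "square_summable v"
  shows "(cmod (\<Sum>n. u n * cnj (v n)))\<^sup>2 \<le> (\<Sum>n. (cmod (u n))\<^sup>2) * (\<Sum>n. (cmod (v n))\<^sup>2)"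
proof -
  have "(\<lambda>N. (cmod (\<Sum>n<N. u n * cnj (v n)))\<^sup>2) \<longlonglongrightarrow> (cmod (\<Sum>n. u n * cnj (v n)))\<^sup>2"
    by (intro tendsto_intros summable_LIMSEQ summable_norm_cancel[OF summable_mult_square_summable] assms)
  moreover have "(cmod (\<Sum>n<N. u n * cnj (v n)))\<^sup>2 \<le> (\<Sum>n. (cmod (u n))\<^sup>2) * (\<Sum>n. (cmod (v n))\<^sup>2)" for N
  proof -
    have "(cmod (\<Sum>n<N. u n * cnj (v n)))\<^sup>2 \<le> (\<Sum>n<N. cmod (u n) * cmod (v n))\<^sup>2"
      by (intro power_mono) (auto intro: order_trans[OF norm_sum] simp: norm_mult)
    also have "\<dots> \<le> (\<Sum>n<N. (cmod (u n))\<^sup>2) * (\<Sum>n<N. (cmod (v n))\<^sup>2)"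
      by (rule Cauchy_Schwarz_ineq_sum)
    also have "\<dots> \<le> (\<Sum>n. (cmod (u n))\<^sup>2) * (\<Sum>n. (cmod (v n))\<^sup>2)"
      using assms unfolding square_summable_def
      by (intro mult_mono sum_le_suminf sum_nonneg suminf_nonneg) auto
    finally show ?thesis .
  qed
  ultimately show ?thesis by (intro LIMSEQ_le_const2) auto
qed

lemma suminf_delta_complex:
  fixes f :: "nat \<Rightarrow> complex"
  shows "(\<Sum>n. (if n = k then x else 0) * f n) = x * f k"
  by (subst suminf_finite[of "{k}"]) auto

text \<open>
  Since |t n| tends to infinity, only finitely many quotients can be large.  The convention x /
  0 = 0 makes the bound hold even if z is one of the t n.
\<close>
lemma bounded_inverse_shift:
  assumes "filterlim (\<lambda>n. \<bar>t n :: real\<bar>) at_top sequentially"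
  obtains K where "\<And>n. cmod (1 / (of_real (t n) - z)) \<le> K"
    "\<And>n. cmod (of_real (t n) / (of_real (t n) - z)) \<le> K"
proof -
  have ev: "eventually (\<lambda>n. 2 * cmod z + 1 \<le> \<bar>t n\<bar>) sequentially"
    using assms by (simp add: filterlim_at_top)
  have ev': "eventually (\<lambda>n. cmod (of_real (t n) / (of_real (t n) - z)) \<le> 2 \<and> cmod (1 / (of_real (t n) - z)) \<le> 2) sequentially"
    using ev
  proof eventually_elim
    case (elim n)
    have "\<bar>t n\<bar> - cmod z \<le> cmod (of_real (t n) - z)"
      using norm_triangle_ineq2[of "of_real (t n)" z] by simp
    then have "\<bar>t n\<bar> \<le> 2 * cmod (of_real (t n) - z)" "1 \<le> 2 * cmod (of_real (t n) - z)"
      using elim norm_ge_zero[of z] by linarith+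
    moreover then have "0 < cmod (of_real (t n) - z)" by linarith
    ultimately show ?case by (simp add: norm_divide divide_le_eq)
  qed
  have "Bseq (\<lambda>n. of_real (t n) / (of_real (t n) - z))" "Bseq (\<lambda>n. 1 / (of_real (t n) - z))"
    by (rule BfunI[where K = 2], use ev' in \<open>eventually_elim, simp\<close>)+
  then obtain K1 K2 where "\<And>n. cmod (of_real (t n) / (of_real (t n) - z)) \<le> K1" "\<And>n. cmod (1 / (of_real (t n) - z)) \<le> K2"
    "K1 > 0" "K2 > 0"
    unfolding Bseq_def by blast
  then show ?thesis by (intro that[of "max K1 K2"]) (auto simp: le_max_iff_disj)
qed

section \<open>The spectrum of a rank one perturbation\<close>

text \<open>
  With c n = \<alpha> n * cnj (\<beta> n) this is \<kappa> + <(A - z)^(-1) a - A^(-1) a, b>,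
  where A is the multiplication operator: the summands are c n * (1 / (t n - z) - 1 / t n),
  combined so that the series converges absolutely.
\<close>
definition coupling_function :: "(nat \<Rightarrow> real) \<Rightarrow> (nat \<Rightarrow> complex) \<Rightarrow> complex \<Rightarrow> complex \<Rightarrow> complex" where
  "coupling_function t c \<kappa> z = \<kappa> + (\<Sum>n. c n * z / (of_real (t n) * (of_real (t n) - z)))"

locale rank_one_data =
  fixes t w :: "nat \<Rightarrow> real" and a b :: "real \<Rightarrow> complex" and \<kappa> :: complex
  assumes t: "spectral_sequence t" and w: "\<And>n. w n > 0"
    and adm: "admissible_data (atomic_measure t w) a b \<kappa>"
begin

abbreviation "M \<equiv> atomic_measure t w"
abbreviation "R \<equiv> rank_one_perturbation M a b \<kappa>"
abbreviation "\<alpha> \<equiv> atomic_coeff t w a"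
abbreviation "\<beta> \<equiv> atomic_coeff t w b"
abbreviation "\<tau> n \<equiv> complex_of_real (t n)"

text \<open>
  The coordinates \<eta> of y0 together with the number c parametrize the domain of the
  perturbation; here the constraint linking them is expressed in coordinates.
\<close>
definition in_domain :: "(nat \<Rightarrow> complex) \<Rightarrow> complex \<Rightarrow> bool" where
  "in_domain \<eta> c \<longleftrightarrow> square_summable \<eta> \<and> square_summable (\<lambda>n. \<tau> n * \<eta> n) \<and>
     \<kappa> * c + (\<Sum>n. \<eta> n * cnj (\<beta> n)) = 0"

definition domain_vec :: "(nat \<Rightarrow> complex) \<Rightarrow> complex \<Rightarrow> nat \<Rightarrow> complex" where
  "domain_vec \<eta> c n = \<eta> n + c * (\<alpha> n / \<tau> n)"

text \<open>
  The coordinates of (L - z) y for the vector y with parameters \<eta> and c.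
\<close>
definition defect :: "complex \<Rightarrow> (nat \<Rightarrow> complex) \<Rightarrow> complex \<Rightarrow> nat \<Rightarrow> complex" where
  "defect z \<eta> c n = \<tau> n * \<eta> n - z * domain_vec \<eta> c n"

lemma t_inj: "inj t" and t_nz [simp]: "t n \<noteq> 0" and t_lim: "filterlim (\<lambda>n. \<bar>t n\<bar>) at_top sequentially"
  using t by (auto simp: spectral_sequence_def)

lemma coeff_div: "atomic_coeff t w (\<lambda>x. f x / of_real x) n = atomic_coeff t w f n / \<tau> n"
  and coeff_mult: "atomic_coeff t w (\<lambda>x. of_real x * f x) n = \<tau> n * atomic_coeff t w f n"
  by (simp_all add: atomic_coeff_def)

lemma coeff_eq_iff: "atomic_coeff t w f n = atomic_coeff t w g n \<longleftrightarrow> f (t n) = g (t n)"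
  using w[of n] by (simp add: atomic_coeff_def)

lemma measurable_ab: "a \<in> borel_measurable borel" "b \<in> borel_measurable borel"
  using adm by (auto simp: admissible_data_def borel_measurable_atomic)

lemma square_summable_\<alpha>: "square_summable (\<lambda>n. \<alpha> n / \<tau> n)" and square_summable_\<beta>: "square_summable (\<lambda>n. \<beta> n / \<tau> n)"
  using adm L2_atomic_iff[of w, OF w] by (auto simp: admissible_data_def square_summable_def coeff_div)

text \<open>
  b itself need not be square integrable; the factor t n is moved from b to \<eta>.
\<close>
lemma summable_pairing:
  assumes "square_summable (\<lambda>n. \<tau> n * \<eta> n)"
  shows "summable (\<lambda>n. cmod (\<eta> n * cnj (\<beta> n)))"
  using summable_mult_square_summable[OF assms square_summable_\<beta>] by (simp add: norm_mult norm_divide)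

lemma graph_iff:
  "(y, v) \<in> R \<longleftrightarrow> y \<in> L2 M \<and> v \<in> L2 M \<and> (\<exists>\<eta> c. in_domain \<eta> c \<and>
     (\<forall>n. atomic_coeff t w y n = domain_vec \<eta> c n) \<and> (\<forall>n. atomic_coeff t w v n = \<tau> n * \<eta> n))"
  (is "_ \<longleftrightarrow> _ \<and> _ \<and> ?E")
proof -
  have "(\<exists>y0\<in>mult_domain M. \<exists>c. \<kappa> * c + L2_pairing M y0 b = 0 \<and>
          (AE x in M. y x = y0 x + c * (a x / of_real x)) \<and> (AE x in M. v x = of_real x * y0 x)) \<longleftrightarrow> ?E"
  proof safe
    fix y0 c
    assume y0: "y0 \<in> mult_domain M" and eq: "\<kappa> * c + L2_pairing M y0 b = 0"
      "AE x in M. y x = y0 x + c * (a x / of_real x)" "AE x in M. v x = of_real x * y0 x"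
    let ?\<eta> = "atomic_coeff t w y0"
    have 1: "y0 \<in> borel_measurable borel" "square_summable ?\<eta>" "square_summable (\<lambda>n. \<tau> n * ?\<eta> n)"
      using y0 L2_atomic_iff[of w, OF w] by (auto simp: mult_domain_def square_summable_def coeff_mult)
    have 2: "in_domain ?\<eta> c"
      using 1 eq(1) L2_pairing_atomic[of w, OF w 1(1) measurable_ab(2) summable_pairing] by (auto simp: in_domain_def)
    have 3: "y (t n) = y0 (t n) + c * (a (t n) / \<tau> n)" "v (t n) = \<tau> n * y0 (t n)" for n
      using eq(2,3) unfolding AE_atomic_measure_iff[of w, OF w] by auto
    show ?E
      by (rule exI[of _ ?\<eta>], rule exI[of _ c]) (simp add: 2 domain_vec_def atomic_coeff_def 3 algebra_simps)
  next
    fix \<eta> c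
    assume d: "in_domain \<eta> c" and eq: "\<forall>n. atomic_coeff t w y n = domain_vec \<eta> c n" "\<forall>n. atomic_coeff t w v n = \<tau> n * \<eta> n"
    let ?y0 = "atomic_function t w \<eta>"
    have c: "atomic_coeff t w ?y0 = \<eta>" by (rule atomic_coeff_atomic_function) (use w t_inj in auto)
    have m: "?y0 \<in> borel_measurable borel" by (rule atomic_function_measurable)
    have 1: "?y0 \<in> mult_domain M"
      using d m unfolding mult_domain_def mem_Collect_eq L2_atomic_iff[of w, OF w]
      by (auto simp: c in_domain_def coeff_mult square_summable_def)
    have 2: "\<kappa> * c + L2_pairing M ?y0 b = 0"
      using d L2_pairing_atomic[of w ?y0 b t, OF w m measurable_ab(2)] summable_pairing unfolding c by (auto simp: in_domain_def)
    have "atomic_coeff t w y n = atomic_coeff t w (\<lambda>x. ?y0 x + c * (a x / of_real x)) n" for n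
      using eq(1) fun_cong[OF c, of n]
      by (simp add: domain_vec_def atomic_coeff_def[of t w "\<lambda>x. _ x + _ x"] atomic_coeff_def[of t w a]
        atomic_coeff_def[of t w ?y0] distrib_left mult.left_commute)
    then have 3: "AE x in M. y x = ?y0 x + c * (a x / of_real x)"
      unfolding AE_atomic_measure_iff[of w, OF w] coeff_eq_iff by blast
    have "atomic_coeff t w v n = atomic_coeff t w (\<lambda>x. of_real x * ?y0 x) n" for n
      using eq(2) fun_cong[OF c, of n] by (simp add: coeff_mult)
    then have 4: "AE x in M. v x = of_real x * ?y0 x"
      unfolding AE_atomic_measure_iff[of w, OF w] coeff_eq_iff by blast
    show "\<exists>y0\<in>mult_domain M. \<exists>c. \<kappa> * c + L2_pairing M y0 b = 0 \<and>
          (AE x in M. y x = y0 x + c * (a x / of_real x)) \<and> (AE x in M. v x = of_real x * y0 x)"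
      using 1 2 3 4 by blast
  qed
  then show ?thesis by (simp add: rank_one_perturbation_def)
qed

lemma square_summable_domain_vec: "in_domain \<eta> c \<Longrightarrow> square_summable (domain_vec \<eta> c)"
  unfolding domain_vec_def in_domain_def by (intro square_summable_add square_summable_cmult square_summable_\<alpha>) auto

lemma square_summable_defect: "in_domain \<eta> c \<Longrightarrow> square_summable (defect z \<eta> c)"
  using square_summable_add[of "\<lambda>n. \<tau> n * \<eta> n" "\<lambda>n. (-z) * domain_vec \<eta> c n"]
    square_summable_cmult[OF square_summable_domain_vec, of \<eta> c "-z"]
  by (simp add: in_domain_def defect_def[abs_def])

lemma coefficients_realizable:
  assumes "square_summable u"
  obtains f where "f \<in> L2 M" "atomic_coeff t w f = u"
  using assms that[of "atomic_function t w u"] atomic_coeff_atomic_function[of w t u, OF w t_inj]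
    L2_atomic_iff[of w, OF w] atomic_function_measurable by metis

lemma graph_element_realizable:
  assumes "in_domain \<eta> c"
  obtains y v where "(y, v) \<in> R" "atomic_coeff t w y = domain_vec \<eta> c" "\<And>n. atomic_coeff t w v n = \<tau> n * \<eta> n"
proof -
  obtain y where y: "y \<in> L2 M" "atomic_coeff t w y = domain_vec \<eta> c"
    using coefficients_realizable[OF square_summable_domain_vec[OF assms]] .
  obtain v where v: "v \<in> L2 M" "atomic_coeff t w v = (\<lambda>n. \<tau> n * \<eta> n)"
    using coefficients_realizable assms by (auto simp: in_domain_def)
  show ?thesis by (rule that[of y v]) (use y v assms in \<open>auto simp: graph_iff\<close>)
qed

lemma coeff_defect:
  assumes "atomic_coeff t w y n = domain_vec \<eta> c n" "atomic_coeff t w v n = \<tau> n * \<eta> n"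
  shows "atomic_coeff t w (\<lambda>x. v x - z * y x) n = defect z \<eta> c n"
  unfolding defect_def assms[symmetric] by (simp add: atomic_coeff_def algebra_simps)

lemma AE_eq_iff_coeff: "(AE x in M. f x = g x) \<longleftrightarrow> (\<forall>n. atomic_coeff t w f n = atomic_coeff t w g n)"
  by (simp add: AE_atomic_measure_iff[of w, OF w] coeff_eq_iff)

lemma coeff_0: "atomic_coeff t w (\<lambda>x. 0) n = 0" by (simp add: atomic_coeff_def)

lemma resolvent_injective:
  assumes "z \<in> resolvent_set M R" "in_domain \<eta> c" "\<And>n. defect z \<eta> c n = 0"
  shows "domain_vec \<eta> c n = 0"
proof -
  obtain y v where yv: "(y, v) \<in> R" "atomic_coeff t w y = domain_vec \<eta> c" "\<And>n. atomic_coeff t w v n = \<tau> n * \<eta> n"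
    using graph_element_realizable[OF assms(2)] by metis
  have "AE x in M. v x - z * y x = 0"
    unfolding AE_eq_iff_coeff coeff_0 using coeff_defect[of y _ \<eta> c v z] yv assms(3) by simp
  then have "AE x in M. y x = 0" using assms(1) yv(1) unfolding resolvent_set_def by blast
  then show ?thesis unfolding AE_eq_iff_coeff coeff_0 yv(2) by simp
qed

lemma resolvent_surjective:
  assumes "z \<in> resolvent_set M R" "square_summable \<gamma>"
  obtains \<eta> c where "in_domain \<eta> c" "\<And>n. defect z \<eta> c n = \<gamma> n"
proof -
  obtain g where g: "g \<in> L2 M" "atomic_coeff t w g = \<gamma>" using coefficients_realizable[OF assms(2)] .
  then obtain y v where yv: "(y, v) \<in> R" "AE x in M. v x - z * y x = g x"
    using assms(1) by (auto simp: resolvent_set_def)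
  then obtain \<eta> c where e: "in_domain \<eta> c" "\<And>n. atomic_coeff t w y n = domain_vec \<eta> c n" "\<And>n. atomic_coeff t w v n = \<tau> n * \<eta> n"
    by (auto simp: graph_iff)
  show ?thesis
    by (rule that[OF e(1)]) (use yv(2) coeff_defect[OF e(2,3)] g(2) in \<open>simp add: AE_eq_iff_coeff\<close>)
qed

text \<open>
  An estimate of squared norms already contains injectivity, so that only solvability and the
  estimate have to be supplied.
\<close>
lemma resolventI:
  assumes surj: "\<And>\<gamma>. square_summable \<gamma> \<Longrightarrow> \<exists>\<eta> c. in_domain \<eta> c \<and> (\<forall>n. defect z \<eta> c n = \<gamma> n)"
    and bound: "\<And>\<eta> c. in_domain \<eta> c \<Longrightarrow>
      (\<Sum>n. (cmod (domain_vec \<eta> c n))\<^sup>2) \<le> C * (\<Sum>n. (cmod (defect z \<eta> c n))\<^sup>2)"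
  shows "z \<in> resolvent_set M R"
proof -
  have estimate: "L2_norm M y \<le> sqrt C * L2_norm M (\<lambda>x. v x - z * y x) \<and>
      ((AE x in M. v x - z * y x = 0) \<longrightarrow> (AE x in M. y x = 0))" if yv: "(y, v) \<in> R" for y v
  proof (intro conjI impI)
  obtain \<eta> c where e: "in_domain \<eta> c" "\<And>n. atomic_coeff t w y n = domain_vec \<eta> c n" "\<And>n. atomic_coeff t w v n = \<tau> n * \<eta> n"
    and L: "y \<in> L2 M" "v \<in> L2 M"
    using yv by (auto simp: graph_iff)
  have d: "atomic_coeff t w (\<lambda>x. v x - z * y x) n = defect z \<eta> c n" for n
    by (rule coeff_defect[OF e(2,3)])
  have dss: "square_summable (defect z \<eta> c)" by (rule square_summable_defect[OF e(1)])
  have "(\<lambda>x. v x - z * y x) \<in> borel_measurable borel"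
    using L L2_atomic_iff[of w, OF w] by (intro borel_measurable_diff borel_measurable_times borel_measurable_const) auto
  then have dL: "(\<lambda>x. v x - z * y x) \<in> L2 M"
    using dss unfolding L2_atomic_iff[of w, OF w] by (simp add: square_summable_def d)
  show "L2_norm M y \<le> sqrt C * L2_norm M (\<lambda>x. v x - z * y x)"
    unfolding L2_norm_atomic[of w, OF w L(1)] L2_norm_atomic[of w, OF w dL] e(2) d real_sqrt_mult[symmetric]
    by (rule real_sqrt_le_mono[OF bound[OF e(1)]])
    assume "AE x in M. v x - z * y x = 0"
    then have "defect z \<eta> c n = 0" for n unfolding AE_eq_iff_coeff d coeff_0 by simp
    then have "(\<Sum>n. (cmod (domain_vec \<eta> c n))\<^sup>2) \<le> 0" using bound[OF e(1)] by simp
    moreover have "summable (\<lambda>n. (cmod (domain_vec \<eta> c n))\<^sup>2)"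
      using square_summable_domain_vec[OF e(1)] by (simp add: square_summable_def)
    ultimately have "(cmod (domain_vec \<eta> c n))\<^sup>2 = 0" for n
      using suminf_eq_zero_iff[of "\<lambda>n. (cmod (domain_vec \<eta> c n))\<^sup>2"] suminf_nonneg[of "\<lambda>n. (cmod (domain_vec \<eta> c n))\<^sup>2"]
      by force
    then show "AE x in M. y x = 0" unfolding AE_eq_iff_coeff e(2) coeff_0 by simp
  qed
  have solvable: "\<exists>(y, v)\<in>R. AE x in M. v x - z * y x = g x" if g: "g \<in> L2 M" for g
  proof -
  obtain \<eta> c where e: "in_domain \<eta> c" "\<And>n. defect z \<eta> c n = atomic_coeff t w g n"
    using g surj L2_atomic_iff[of w, OF w] by metis
  obtain y v where yv: "(y, v) \<in> R" "atomic_coeff t w y = domain_vec \<eta> c" "\<And>n. atomic_coeff t w v n = \<tau> n * \<eta> n"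
    using graph_element_realizable[OF e(1)] by metis
  have "AE x in M. v x - z * y x = g x"
    unfolding AE_eq_iff_coeff using coeff_defect[of y _ \<eta> c v z] yv e(2) by simp
  then show "\<exists>(y, v)\<in>R. AE x in M. v x - z * y x = g x" using yv(1) by blast
  qed
  show ?thesis
    unfolding resolvent_set_def using estimate solvable by blast
qed

definition "coupling n = \<alpha> n * cnj (\<beta> n)"

lemma summable_coupling: "summable (\<lambda>n. cmod (coupling n) / (t n)\<^sup>2)"
  using summable_mult_square_summable[OF square_summable_\<alpha> square_summable_\<beta>]
  by (simp add: coupling_def norm_mult norm_divide power2_eq_square)

text \<open>
  If \<alpha> n = 0, the n-th coordinate of (L - t n) y vanishes for every y in the domain, and
  surjectivity fails.  If \<beta> n = 0, the n-th unit vector satisfies the constraint with c =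
  0 and is an eigenvector.
\<close>
lemma coupling_nonzero:
  assumes "\<And>z. z \<in> resolvent_set M R"
  shows "coupling n \<noteq> 0"
proof
  assume "coupling n = 0"
  then consider "\<alpha> n = 0" | "\<beta> n = 0" by (auto simp: coupling_def)
  then show False
  proof cases
    case 1
    obtain \<eta> c where e: "in_domain \<eta> c" "\<And>k. defect (\<tau> n) \<eta> c k = (if k = n then 1 else 0)"
      using resolvent_surjective[OF assms square_summable_delta] by metis
    from e(2)[of n] 1 show False by (simp add: defect_def domain_vec_def)
  next
    case 2
    let ?\<eta> = "\<lambda>k. if k = n then 1 else 0 :: complex"
    have "square_summable (\<lambda>k. \<tau> k * ?\<eta> k)"
      using square_summable_delta[of n "\<tau> n"] by (rule back_subst[of square_summable]) auto
    then have d: "in_domain ?\<eta> 0"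
      using 2 square_summable_delta[of n 1] suminf_delta_complex[of n 1 "\<lambda>k. cnj (\<beta> k)"] by (simp add: in_domain_def)
    have "domain_vec ?\<eta> 0 n = 0"
      by (rule resolvent_injective[OF assms[of "\<tau> n"] d]) (auto simp: defect_def domain_vec_def)
    then show False by (simp add: domain_vec_def)
  qed
qed

lemma bounded_inverse_shift_\<tau>: "\<exists>K. \<forall>n. cmod (1 / (\<tau> n - z)) \<le> K \<and> cmod (\<tau> n / (\<tau> n - z)) \<le> K"
  by (rule bounded_inverse_shift[OF t_lim, of z]) blast

text \<open>
  The formula for \<eta> obtained by solving (L - z) y = g in each coordinate.  At an index with
  t n = z it has the value 0, and the correct coordinate has to be added separately.
\<close>
lemma square_summable_resolvent_formula:
  assumes \<gamma>: "square_summable \<gamma>"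
  shows "square_summable (\<lambda>n. (\<gamma> n + z * c * (\<alpha> n / \<tau> n)) / (\<tau> n - z))" (is "square_summable ?\<eta>")
    and "square_summable (\<lambda>n. \<tau> n * ((\<gamma> n + z * c * (\<alpha> n / \<tau> n)) / (\<tau> n - z)))"
proof -
  obtain K where K: "\<And>n. cmod (1 / (\<tau> n - z)) \<le> K" "\<And>n. cmod (\<tau> n / (\<tau> n - z)) \<le> K"
    using bounded_inverse_shift_\<tau> by blast
  have s: "square_summable (\<lambda>n. \<gamma> n + z * c * (\<alpha> n / \<tau> n))"
    by (intro square_summable_add square_summable_cmult \<gamma> square_summable_\<alpha>)
  show "square_summable ?\<eta>"
    using square_summable_bounded_mult[OF s K(1)] by (simp add: field_simps)
  show "square_summable (\<lambda>n. \<tau> n * ((\<gamma> n + z * c * (\<alpha> n / \<tau> n)) / (\<tau> n - z)))"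
    using square_summable_bounded_mult[OF s K(2)] by (simp add: field_simps)
qed

lemma square_summable_\<beta>_shift: "square_summable (\<lambda>n. \<beta> n / cnj (\<tau> n - z))"
proof -
  obtain K where K: "\<And>n. cmod (\<tau> n / (\<tau> n - z)) \<le> K"
    using bounded_inverse_shift_\<tau> by blast
  have "cmod (\<tau> n / cnj (\<tau> n - z)) \<le> K" for n
    using K[of n] by (simp add: norm_divide flip: complex_cnj_diff)
  from square_summable_bounded_mult[OF square_summable_\<beta>, of "\<lambda>n. \<tau> n / cnj (\<tau> n - z)", OF this] show ?thesis by simp
qed

text \<open>
  Inserting the formula into the constraint separates the right-hand side g from the number c;
  the factor of c is, together with \<kappa>, the coupling function.
\<close>
lemma pairing_resolvent_formula:
  assumes \<gamma>: "square_summable \<gamma>"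
  shows "(\<Sum>n. (\<gamma> n + z * c * (\<alpha> n / \<tau> n)) / (\<tau> n - z) * cnj (\<beta> n)) =
    (\<Sum>n. \<gamma> n * cnj (\<beta> n / cnj (\<tau> n - z))) + c * (\<Sum>n. coupling n * z / (\<tau> n * (\<tau> n - z)))"
proof -
  have s1: "summable (\<lambda>n. \<gamma> n * cnj (\<beta> n / cnj (\<tau> n - z)))"
    by (intro summable_norm_cancel[OF summable_mult_square_summable] \<gamma> square_summable_\<beta>_shift)
  have "summable (\<lambda>n. \<alpha> n / \<tau> n * cnj (\<beta> n / cnj (\<tau> n - z)))"
    by (intro summable_norm_cancel[OF summable_mult_square_summable] square_summable_\<alpha> square_summable_\<beta>_shift)
  then have "summable (\<lambda>n. z * (\<alpha> n / \<tau> n * cnj (\<beta> n / cnj (\<tau> n - z))))" by (rule summable_mult)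
  then have s2: "summable (\<lambda>n. coupling n * z / (\<tau> n * (\<tau> n - z)))"
    by (rule back_subst[of summable]) (auto simp: coupling_def field_simps)
  show ?thesis
    unfolding suminf_mult[OF s2, symmetric] suminf_add[OF s1 summable_mult[OF s2]]
    by (intro suminf_cong) (simp add: coupling_def add_divide_distrib distrib_right)
qed

text \<open>
  At a zero of the coupling function the choice g = 0, c = 1 satisfies the constraint and yields
  an eigenvector.
\<close>
lemma coupling_function_nonzero:
  assumes "\<And>z. z \<in> resolvent_set M R" "z \<notin> range \<tau>"
  shows "coupling_function t coupling \<kappa> z \<noteq> 0"
proof
  assume 0: "coupling_function t coupling \<kappa> z = 0"
  have nz: "\<tau> n - z \<noteq> 0" for n using assms(2) by auto
  let ?\<eta> = "\<lambda>n. (0 + z * 1 * (\<alpha> n / \<tau> n)) / (\<tau> n - z)"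
  have ss0: "square_summable (\<lambda>n. 0)" by (simp add: square_summable_def)
  have "in_domain ?\<eta> 1"
    unfolding in_domain_def pairing_resolvent_formula[OF ss0, of z 1] using square_summable_resolvent_formula[OF ss0, of z 1] 0
    by (simp add: coupling_function_def)
  moreover have "defect z ?\<eta> 1 n = 0" for n
    using nz[of n] by (simp add: defect_def domain_vec_def divide_simps) (simp add: algebra_simps)
  ultimately have "domain_vec ?\<eta> 1 0 = 0" using resolvent_injective[OF assms(1)] by blast
  then have "\<alpha> 0 = 0" using nz[of 0] by (simp add: domain_vec_def divide_simps) (simp add: algebra_simps)
  then show False using coupling_nonzero[OF assms(1), of 0] by (simp add: coupling_def)
qed

lemma solve_defect:
  assumes "\<tau> n \<noteq> z"
  shows "defect z \<eta> c n = \<gamma> \<longleftrightarrow> \<eta> n = (\<gamma> + z * c * (\<alpha> n / \<tau> n)) / (\<tau> n - z)"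
    and "domain_vec \<eta> c n = (defect z \<eta> c n + c * \<alpha> n) / (\<tau> n - z)"
  using assms unfolding defect_def domain_vec_def by (auto simp: field_simps)

text \<open>
  Away from an exceptional index k with t k = z, each coordinate of y is bounded by those of g
  and of c * a / (x - z).  So the whole norm is controlled as soon as c, and the k-th coordinate
  if it is exceptional, are.
\<close>
lemma norm_estimate:
  assumes d: "in_domain \<eta> c"
    and c: "(cmod c)\<^sup>2 \<le> P * (\<Sum>n. (cmod (defect z \<eta> c n))\<^sup>2)"
    and K: "\<And>n. cmod (1 / (\<tau> n - z)) \<le> K"
    and nk: "\<And>n. n \<noteq> k \<Longrightarrow> \<tau> n \<noteq> z"
    and vk: "\<tau> k = z \<Longrightarrow> (cmod (domain_vec \<eta> c k))\<^sup>2 \<le> D * (\<Sum>n. (cmod (defect z \<eta> c n))\<^sup>2)" and D: "D \<ge> 0"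
  shows "(\<Sum>n. (cmod (domain_vec \<eta> c n))\<^sup>2) \<le>
    (2 * K\<^sup>2 + 2 * P * (\<Sum>n. (cmod (\<alpha> n / (\<tau> n - z)))\<^sup>2) + D) * (\<Sum>n. (cmod (defect z \<eta> c n))\<^sup>2)"
proof -
  let ?\<gamma> = "defect z \<eta> c"
  let ?N = "\<Sum>n. (cmod (?\<gamma> n))\<^sup>2"
  let ?a = "\<lambda>n. (cmod (\<alpha> n / (\<tau> n - z)))\<^sup>2"
  let ?e = "\<lambda>n. if n = k then D * ?N else 0"
  have s\<gamma>: "summable (\<lambda>n. (cmod (?\<gamma> n))\<^sup>2)" using square_summable_defect[OF d] by (simp add: square_summable_def)
  have N0: "?N \<ge> 0" by (intro suminf_nonneg s\<gamma>) auto
  obtain K' where K': "\<And>n. cmod (\<tau> n / (\<tau> n - z)) \<le> K'" using bounded_inverse_shift_\<tau> by blast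
  have "square_summable (\<lambda>n. \<tau> n / (\<tau> n - z) * (\<alpha> n / \<tau> n))"
    by (rule square_summable_bounded_mult[OF square_summable_\<alpha> K'])
  then have sa: "summable ?a" by (simp add: square_summable_def)
  have term_le: "(cmod (domain_vec \<eta> c n))\<^sup>2 \<le> 2 * K\<^sup>2 * (cmod (?\<gamma> n))\<^sup>2 + 2 * (cmod c)\<^sup>2 * ?a n + ?e n" for n
  proof (cases "\<tau> n = z")
    case True
    then have "n = k" using nk by blast
    then show ?thesis using vk True by (intro order_trans[OF vk[folded \<open>n = k\<close>]]) auto
  next
    case False
    have "domain_vec \<eta> c n = 1 / (\<tau> n - z) * ?\<gamma> n + c * (\<alpha> n / (\<tau> n - z))"
      unfolding solve_defect(2)[OF False, of \<eta> c] by (simp add: add_divide_distrib)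
    then have "(cmod (domain_vec \<eta> c n))\<^sup>2 \<le> 2 * (cmod (1 / (\<tau> n - z) * ?\<gamma> n))\<^sup>2 + 2 * (cmod (c * (\<alpha> n / (\<tau> n - z))))\<^sup>2"
      using cmod_add_sq_le by metis
    also have "(cmod (1 / (\<tau> n - z) * ?\<gamma> n))\<^sup>2 \<le> K\<^sup>2 * (cmod (?\<gamma> n))\<^sup>2"
      unfolding norm_mult power_mult_distrib by (intro mult_right_mono power_mono K) auto
    also have "(cmod (c * (\<alpha> n / (\<tau> n - z))))\<^sup>2 = (cmod c)\<^sup>2 * ?a n"
      by (simp only: norm_mult power_mult_distrib)
    finally have "(cmod (domain_vec \<eta> c n))\<^sup>2 \<le> 2 * K\<^sup>2 * (cmod (?\<gamma> n))\<^sup>2 + 2 * (cmod c)\<^sup>2 * ?a n"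
      by (simp add: mult.assoc)
    moreover have "?e n \<ge> 0" using D N0 by simp
    ultimately show ?thesis by linarith
  qed
  have se: "summable ?e" by (rule summable_finite[of "{k}"]) auto
  have "(\<Sum>n. (cmod (domain_vec \<eta> c n))\<^sup>2) \<le> (\<Sum>n. 2 * K\<^sup>2 * (cmod (?\<gamma> n))\<^sup>2 + 2 * (cmod c)\<^sup>2 * ?a n + ?e n)"
    using square_summable_domain_vec[OF d] by (intro suminf_le term_le summable_add summable_mult s\<gamma> sa se)
      (simp add: square_summable_def)
  also have "\<dots> = 2 * K\<^sup>2 * ?N + 2 * (cmod c)\<^sup>2 * (\<Sum>n. ?a n) + (\<Sum>n. ?e n)"
    by (simp add: suminf_add[symmetric] suminf_mult summable_add summable_mult s\<gamma> sa se)
  also have "(\<Sum>n. ?e n) = D * ?N" by (subst suminf_finite[of "{k}"]) auto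
  also have "2 * (cmod c)\<^sup>2 * (\<Sum>n. ?a n) \<le> 2 * (P * ?N) * (\<Sum>n. ?a n)"
    by (intro mult_right_mono mult_left_mono c suminf_nonneg sa) auto
  finally show ?thesis by (simp add: algebra_simps)
qed

lemma pairing_bound:
  fixes \<gamma> :: "nat \<Rightarrow> complex"
  assumes "square_summable \<gamma>"
  shows "(cmod (\<Sum>n. \<gamma> n * cnj (\<beta> n / cnj (\<tau> n - z))))\<^sup>2 \<le>
    (\<Sum>n. (cmod (\<gamma> n))\<^sup>2) * (\<Sum>n. (cmod (\<beta> n / cnj (\<tau> n - z)))\<^sup>2)"
  by (rule Cauchy_Schwarz_suminf[OF assms square_summable_\<beta>_shift])

text \<open>
  Here c is determined by the constraint, in which its coefficient is the value of the coupling
  function.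
\<close>
lemma resolvent_off_support:
  assumes z: "z \<notin> range \<tau>" and nz: "coupling_function t coupling \<kappa> z \<noteq> 0"
  shows "z \<in> resolvent_set M R"
proof -
  have tz: "\<tau> n \<noteq> z" for n using z by auto
  let ?\<Phi> = "coupling_function t coupling \<kappa> z"
  let ?S = "\<lambda>\<gamma>. \<Sum>n. \<gamma> n * cnj (\<beta> n / cnj (\<tau> n - z))"
  let ?B = "\<Sum>n. (cmod (\<beta> n / cnj (\<tau> n - z)))\<^sup>2"
  let ?h = "\<lambda>\<gamma> c n. (\<gamma> n + z * c * (\<alpha> n / \<tau> n)) / (\<tau> n - z)"
  have constraint: "\<kappa> * c + (\<Sum>n. ?h \<gamma> c n * cnj (\<beta> n)) = c * ?\<Phi> + ?S \<gamma>"
    if "square_summable \<gamma>" for \<gamma> c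
    unfolding pairing_resolvent_formula[OF that] coupling_function_def by (simp add: algebra_simps)
  obtain K where K: "\<And>n. cmod (1 / (\<tau> n - z)) \<le> K" using bounded_inverse_shift_\<tau> by blast
  show ?thesis
  proof (rule resolventI)
    fix \<gamma> assume \<gamma>: "square_summable \<gamma>"
    let ?c = "- ?S \<gamma> / ?\<Phi>"
    have "in_domain (?h \<gamma> ?c) ?c"
      using square_summable_resolvent_formula[OF \<gamma>, of z ?c] constraint[OF \<gamma>, of ?c] nz by (simp add: in_domain_def)
    moreover have "defect z (?h \<gamma> ?c) ?c n = \<gamma> n" for n
      by (simp add: solve_defect(1)[OF tz])
    ultimately show "\<exists>\<eta> c. in_domain \<eta> c \<and> (\<forall>n. defect z \<eta> c n = \<gamma> n)" by blast
  next
    fix \<eta> c assume d: "in_domain \<eta> c"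
    let ?\<gamma> = "defect z \<eta> c"
    have \<gamma>: "square_summable ?\<gamma>" by (rule square_summable_defect[OF d])
    have h: "\<eta> n = ?h ?\<gamma> c n" for n using solve_defect(1)[OF tz, where n = n and \<eta> = \<eta> and c = c and \<gamma> = "?\<gamma> n"] by simp
    have "(\<Sum>n. \<eta> n * cnj (\<beta> n)) = (\<Sum>n. ?h ?\<gamma> c n * cnj (\<beta> n))"
      by (intro suminf_cong arg_cong2[where f = "(*)", OF h refl])
    then have "c * ?\<Phi> + ?S ?\<gamma> = 0"
      unfolding constraint[OF \<gamma>, of c, symmetric] using d by (simp only: in_domain_def)
    then have "c * ?\<Phi> = - ?S ?\<gamma>" by (simp only: eq_neg_iff_add_eq_0)
    then have "cmod (c * ?\<Phi>) = cmod (?S ?\<gamma>)" by (simp only: norm_minus_cancel)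
    then have "(cmod c)\<^sup>2 * (cmod ?\<Phi>)\<^sup>2 = (cmod (?S ?\<gamma>))\<^sup>2"
      by (simp only: norm_mult power_mult_distrib[symmetric])
    also have "\<dots> \<le> (\<Sum>n. (cmod (?\<gamma> n))\<^sup>2) * ?B" by (rule pairing_bound[OF \<gamma>])
    finally have "(cmod c)\<^sup>2 \<le> (?B / (cmod ?\<Phi>)\<^sup>2) * (\<Sum>n. (cmod (?\<gamma> n))\<^sup>2)"
      using nz by (simp add: field_simps)
    from norm_estimate[OF d this K, of 0 0] show "(\<Sum>n. (cmod (domain_vec \<eta> c n))\<^sup>2) \<le>
      (2 * K\<^sup>2 + 2 * (?B / (cmod ?\<Phi>)\<^sup>2) * (\<Sum>n. (cmod (\<alpha> n / (\<tau> n - z)))\<^sup>2) + 0) * (\<Sum>n. (cmod (?\<gamma> n))\<^sup>2)"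
      using tz by blast
  qed
qed

text \<open>
  At z = t k the roles change: the k-th coordinate of the equation reads - c * \<alpha> k = g k
  and determines c, while the constraint determines the k-th coordinate of y0, where its
  coefficient is cnj (\<beta> k).
\<close>
lemma resolvent_on_support:
  assumes nz: "coupling k \<noteq> 0"
  shows "\<tau> k \<in> resolvent_set M R"
proof -
  let ?z = "\<tau> k"
  have \<alpha>k: "\<alpha> k \<noteq> 0" and \<beta>k: "\<beta> k \<noteq> 0" using nz by (auto simp: coupling_def)
  have tz: "\<tau> n \<noteq> ?z" if "n \<noteq> k" for n using that t_inj by (auto simp: inj_def)
  let ?T = "\<Sum>n. coupling n * ?z / (\<tau> n * (\<tau> n - ?z))"
  let ?S = "\<lambda>\<gamma>. \<Sum>n. \<gamma> n * cnj (\<beta> n / cnj (\<tau> n - ?z))"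
  let ?B = "\<Sum>n. (cmod (\<beta> n / cnj (\<tau> n - ?z)))\<^sup>2"
  let ?h = "\<lambda>\<gamma> c n. (\<gamma> n + ?z * c * (\<alpha> n / \<tau> n)) / (\<tau> n - ?z)"
  let ?g = "\<lambda>\<gamma> c d n. ?h \<gamma> c n + (if n = k then d else 0)"
  have constraint: "\<kappa> * c + (\<Sum>n. ?g \<gamma> c d n * cnj (\<beta> n)) = c * (\<kappa> + ?T) + ?S \<gamma> + d * cnj (\<beta> k)"
    if \<gamma>: "square_summable \<gamma>" for \<gamma> c d
  proof -
    have s1: "summable (\<lambda>n. ?h \<gamma> c n * cnj (\<beta> n))"
      by (intro summable_norm_cancel[OF summable_pairing] square_summable_resolvent_formula \<gamma>)
    have s2: "summable (\<lambda>n. (if n = k then d else 0) * cnj (\<beta> n))"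
      by (rule summable_finite[of "{k}"]) auto
    show ?thesis
      unfolding distrib_right suminf_add[OF s1 s2, symmetric] pairing_resolvent_formula[OF \<gamma>] suminf_delta_complex
      by (simp add: algebra_simps)
  qed
  obtain K where K: "\<And>n. cmod (1 / (\<tau> n - ?z)) \<le> K" using bounded_inverse_shift_\<tau> by blast
  have alg: "2 * (q * N) + 2 * (p * N * x) = (2 * q + 2 * p * x) * N" for q N p x :: real
    by (simp add: algebra_simps)
  have defect_k: "defect ?z \<eta> c k = - c * \<alpha> k" for \<eta> c
    by (simp add: defect_def domain_vec_def algebra_simps)
  show ?thesis
  proof (rule resolventI)
    fix \<gamma> assume \<gamma>: "square_summable \<gamma>"
    let ?c = "- \<gamma> k / \<alpha> k"
    \<comment> \<open>The k-th coordinate of y0 that makes the constraint hold.\<close>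
    let ?d = "- (?c * (\<kappa> + ?T) + ?S \<gamma>) / cnj (\<beta> k)"
    have "square_summable (\<lambda>n. \<tau> n * ?h \<gamma> ?c n + (if n = k then \<tau> k * ?d else 0))"
      by (intro square_summable_add square_summable_resolvent_formula \<gamma> square_summable_delta)
    then have "square_summable (\<lambda>n. \<tau> n * ?g \<gamma> ?c ?d n)"
      by (rule back_subst[of square_summable]) (auto simp: algebra_simps)
    moreover have "square_summable (?g \<gamma> ?c ?d)"
      by (intro square_summable_add square_summable_resolvent_formula \<gamma> square_summable_delta)
    moreover have "?c * (\<kappa> + ?T) + ?S \<gamma> + ?d * cnj (\<beta> k) = 0" using \<beta>k by simp
    ultimately have "in_domain (?g \<gamma> ?c ?d) ?c"
      unfolding in_domain_def constraint[OF \<gamma>] by blast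
    moreover have "defect ?z (?g \<gamma> ?c ?d) ?c n = \<gamma> n" for n
    proof (cases "n = k")
      case True then show ?thesis using \<alpha>k defect_k by simp
    next
      case False then show ?thesis by (simp add: solve_defect(1)[OF tz])
    qed
    ultimately show "\<exists>\<eta> c. in_domain \<eta> c \<and> (\<forall>n. defect ?z \<eta> c n = \<gamma> n)" by blast
  next
    fix \<eta> c assume d: "in_domain \<eta> c"
    let ?\<gamma> = "defect ?z \<eta> c"
    let ?N = "\<Sum>n. (cmod (?\<gamma> n))\<^sup>2"
    let ?P = "1 / (cmod (\<alpha> k))\<^sup>2"
    let ?Q = "(2 * (cmod (\<kappa> + ?T))\<^sup>2 * ?P + 2 * ?B) / (cmod (\<beta> k))\<^sup>2"
    let ?D = "2 * ?Q + 2 * ?P * (cmod (\<alpha> k / \<tau> k))\<^sup>2"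
    have \<gamma>: "square_summable ?\<gamma>" by (rule square_summable_defect[OF d])
    have "(cmod (?\<gamma> k))\<^sup>2 \<le> ?N"
      using sum_le_suminf[of "\<lambda>n. (cmod (?\<gamma> n))\<^sup>2" "{k}"] \<gamma> by (simp add: square_summable_def)
    then have c: "(cmod c)\<^sup>2 \<le> ?P * ?N"
      using \<alpha>k by (simp add: defect_k norm_mult power_mult_distrib field_simps)
    have h: "\<eta> n = ?g ?\<gamma> c (\<eta> k) n" for n
    proof (cases "n = k")
      case True then show ?thesis by simp
    next
      case False then show ?thesis
        using solve_defect(1)[OF tz[OF False], of \<eta> c "?\<gamma> n"] by simp
    qed
    have "(\<Sum>n. \<eta> n * cnj (\<beta> n)) = (\<Sum>n. ?g ?\<gamma> c (\<eta> k) n * cnj (\<beta> n))"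
      by (intro suminf_cong arg_cong2[where f = "(*)", OF h refl])
    then have "c * (\<kappa> + ?T) + ?S ?\<gamma> + \<eta> k * cnj (\<beta> k) = 0"
      unfolding constraint[OF \<gamma>, of c "\<eta> k", symmetric] using d by (simp only: in_domain_def)
    then have "\<eta> k * cnj (\<beta> k) = - (c * (\<kappa> + ?T) + ?S ?\<gamma>)"
      by (simp only: eq_neg_iff_add_eq_0 add.commute)
    then have "cmod (\<eta> k * cnj (\<beta> k)) = cmod (c * (\<kappa> + ?T) + ?S ?\<gamma>)"
      by (simp only: norm_minus_cancel)
    then have "(cmod (\<eta> k))\<^sup>2 * (cmod (\<beta> k))\<^sup>2 = (cmod (c * (\<kappa> + ?T) + ?S ?\<gamma>))\<^sup>2"
      by (simp only: norm_mult power_mult_distrib[symmetric] complex_mod_cnj)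
    also have "\<dots> \<le> 2 * (cmod (c * (\<kappa> + ?T)))\<^sup>2 + 2 * (cmod (?S ?\<gamma>))\<^sup>2" by (rule cmod_add_sq_le)
    also have "(cmod (c * (\<kappa> + ?T)))\<^sup>2 \<le> ?P * ?N * (cmod (\<kappa> + ?T))\<^sup>2"
      unfolding norm_mult power_mult_distrib by (intro mult_right_mono c) auto
    also have "(cmod (?S ?\<gamma>))\<^sup>2 \<le> ?N * ?B" by (rule pairing_bound[OF \<gamma>])
    finally have "(cmod (\<eta> k))\<^sup>2 * (cmod (\<beta> k))\<^sup>2 \<le> (2 * (cmod (\<kappa> + ?T))\<^sup>2 * ?P + 2 * ?B) * ?N"
      by (simp add: algebra_simps)
    then have e: "(cmod (\<eta> k))\<^sup>2 \<le> ?Q * ?N"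
      unfolding times_divide_eq_left using \<beta>k by (subst le_divide_eq) auto
    have "(cmod (domain_vec \<eta> c k))\<^sup>2 \<le> 2 * (cmod (\<eta> k))\<^sup>2 + 2 * (cmod (c * (\<alpha> k / \<tau> k)))\<^sup>2"
      unfolding domain_vec_def by (rule cmod_add_sq_le)
    also have "(cmod (c * (\<alpha> k / \<tau> k)))\<^sup>2 \<le> ?P * ?N * (cmod (\<alpha> k / \<tau> k))\<^sup>2"
      unfolding norm_mult power_mult_distrib by (intro mult_right_mono c) auto
    also note e
    also have "2 * (?Q * ?N) + 2 * (?P * ?N * (cmod (\<alpha> k / \<tau> k))\<^sup>2) = ?D * ?N" by (rule alg)
    finally have v: "(cmod (domain_vec \<eta> c k))\<^sup>2 \<le> ?D * ?N" by simp
    have "?B \<ge> 0" using square_summable_\<beta>_shift[of ?z] by (intro suminf_nonneg) (auto simp: square_summable_def)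
    then have "?D \<ge> 0" by (intro add_nonneg_nonneg mult_nonneg_nonneg divide_nonneg_nonneg) auto
    then show "(\<Sum>n. (cmod (domain_vec \<eta> c n))\<^sup>2) \<le>
      (2 * K\<^sup>2 + 2 * ?P * (\<Sum>n. (cmod (\<alpha> n / (\<tau> n - ?z)))\<^sup>2) + ?D) * ?N"
      using norm_estimate[OF d c K tz v] by blast
  qed
qed

text \<open>
  The points of the spectrum off the t n are the zeros of the coupling function, and t n lies in
  the spectrum exactly if c n = 0.  All information on a, b and the masses enters through the
  products c n and through \<kappa>.
\<close>
lemma spectrum_empty_iff:
  "op_spectrum M R = {} \<longleftrightarrow>
    (\<forall>n. coupling n \<noteq> 0) \<and> (\<forall>z. z \<notin> range \<tau> \<longrightarrow> coupling_function t coupling \<kappa> z \<noteq> 0)"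
proof -
  have "op_spectrum M R = {} \<longleftrightarrow> (\<forall>z. z \<in> resolvent_set M R)" by (auto simp: op_spectrum_def)
  also have "\<dots> \<longleftrightarrow> (\<forall>n. coupling n \<noteq> 0) \<and>
      (\<forall>z. z \<notin> range \<tau> \<longrightarrow> coupling_function t coupling \<kappa> z \<noteq> 0)" (is "_ \<longleftrightarrow> ?nz")
  proof
    assume "\<forall>z. z \<in> resolvent_set M R"
    then show ?nz by (intro conjI allI impI coupling_nonzero coupling_function_nonzero) auto
  next
    assume nz: ?nz
    show "\<forall>z. z \<in> resolvent_set M R"
    proof
      fix z
      show "z \<in> resolvent_set M R"
      proof (cases "z \<in> range \<tau>")
        case True
        then show ?thesis using nz resolvent_on_support by auto
      next
        case False
        then show ?thesis using nz by (intro resolvent_off_support) auto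
      qed
    qed
  qed
  finally show ?thesis .
qed

end

text \<open>
  |c n| / (t n)^2 is the product of the coordinates of a/x and b/x up to phases, so the square
  summability of both sequences makes it summable.
\<close>
lemma removable_imp_coupling:
  assumes "spectral_sequence t" "\<And>n. w n > 0" "removable t w"
  obtains c \<kappa> where "\<And>n. c n \<noteq> 0" "summable (\<lambda>n. cmod (c n) / (t n)\<^sup>2)"
    "\<And>z. z \<notin> range (\<lambda>n. complex_of_real (t n)) \<Longrightarrow> coupling_function t c \<kappa> z \<noteq> 0"
proof -
  obtain a b \<kappa> where *: "admissible_data (atomic_measure t w) a b \<kappa>"
    "op_spectrum (atomic_measure t w) (rank_one_perturbation (atomic_measure t w) a b \<kappa>) = {}"
    using assms(3) by (auto simp: removable_def)
  interpret rank_one_data t w a b \<kappa> by unfold_locales (use assms * in auto)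
  show ?thesis
    by (rule that[of coupling \<kappa>]) (use *(2) summable_coupling in \<open>auto simp: spectrum_empty_iff\<close>)
qed

text \<open>
  Split c n = \<alpha> n * cnj (\<beta> n) evenly, with |\<alpha> n| = |\<beta> n| = sqrt |c n|.
  If c is not absolutely summable then a is not square integrable, and no condition is imposed
  on \<kappa>.
\<close>
lemma coupling_imp_removable:
  assumes t: "spectral_sequence t" and w: "\<And>n. w n > 0" and c: "\<And>n. c n \<noteq> 0"
    and s: "summable (\<lambda>n. cmod (c n) / (t n)\<^sup>2)" "\<not> summable (\<lambda>n. cmod (c n))"
    and nz: "\<And>z. z \<notin> range (\<lambda>n. complex_of_real (t n)) \<Longrightarrow> coupling_function t c \<kappa> z \<noteq> 0"
  shows "removable t w"
proof -
  define A where "A n = complex_of_real (sqrt (cmod (c n)))" for n :: nat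
  define B where "B n = cnj (c n / A n)" for n :: nat
  define a where "a = atomic_function t w A"
  define b where "b = atomic_function t w B"
  have inj: "inj t" using t by (simp add: spectral_sequence_def)
  have A0: "A n \<noteq> 0" and A2: "(cmod (A n))\<^sup>2 = cmod (c n)" and B2: "(cmod (B n))\<^sup>2 = cmod (c n)" for n
    using c[of n] by (auto simp: A_def B_def norm_divide power_divide power2_eq_square)
  have ca: "atomic_coeff t w a = A" and cb: "atomic_coeff t w b = B"
    unfolding a_def b_def by (rule atomic_coeff_atomic_function; use w inj in auto)+
  have m: "a \<in> borel_measurable borel" "b \<in> borel_measurable borel"
    by (simp_all add: a_def b_def atomic_function_measurable)
  have div: "atomic_coeff t w (\<lambda>x. f x / of_real x) n = atomic_coeff t w f n / of_real (t n)" for f n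
    by (simp add: atomic_coeff_def)
  have m': "(\<lambda>x. f x / of_real x) \<in> borel_measurable borel" if "f \<in> borel_measurable borel" for f :: "real \<Rightarrow> complex"
    using that by measurable
  have "admissible_data (atomic_measure t w) a b \<kappa>"
    unfolding admissible_data_def L2_atomic_iff[of w, OF w] borel_measurable_atomic
    using m m'[OF m(1)] m'[OF m(2)] s
    by (auto simp: square_summable_def div ca cb norm_divide power_divide A2 B2)
  then interpret rank_one_data t w a b \<kappa> by unfold_locales (use t w in auto)
  have "coupling = c" using A0 by (auto simp: coupling_def ca cb B_def)
  then have "op_spectrum M R = {}" using c nz by (simp add: spectrum_empty_iff)
  then show ?thesis using adm by (auto simp: removable_def)
qed

section \<open>Partial fractions of the reciprocal sine\<close>

text \<open>
  Induction on the index set: each old term times the new factor splits into two simple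
  fractions, and the new coefficient is collected by the induction hypothesis at the new pole.
\<close>
lemma inverse_product_partial_fractions:
  fixes x :: "'a \<Rightarrow> 'b :: field"
  assumes "finite I" "I \<noteq> {}" "inj_on x I" "z \<notin> x ` I"
  shows "(\<Prod>i\<in>I. x i / (x i - z)) =
    (\<Sum>i\<in>I. (\<Prod>j\<in>I - {i}. x j / (x j - x i)) * (x i / (x i - z)))"
  using assms
proof (induction I arbitrary: z rule: finite_ne_induct)
  case (singleton m)
  then show ?case by simp
next
  case (insert m I)
  let ?A = "\<lambda>i. \<Prod>j\<in>I - {i}. x j / (x j - x i)"
  have mz: "x m \<noteq> z" and zI: "z \<notin> x ` I" and mI: "x m \<notin> x ` I" and inj: "inj_on x I"
    using insert by (auto simp: inj_on_insert)
  have split: "x m / (x m - z) * (x i / (x i - z)) =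
      x m / (x m - x i) * (x i / (x i - z)) + x m / (x m - z) * (x i / (x i - x m))" if "i \<in> I" for i
  proof -
    have "x i \<noteq> x m" using that mI by (metis image_eqI)
    then have "x i - z \<noteq> 0" "x m - z \<noteq> 0" "x m - x i \<noteq> 0" "x i - x m \<noteq> 0"
      using that mz zI by auto
    then show ?thesis by (simp add: divide_simps) (simp add: algebra_simps)
  qed
  have "(\<Prod>i\<in>insert m I. x i / (x i - z)) = (\<Sum>i\<in>I. ?A i * (x m / (x m - z) * (x i / (x i - z))))"
    using insert.hyps insert.IH[OF inj zI] by (simp add: sum_distrib_left mult.left_commute)
  also have "\<dots> = (\<Sum>i\<in>I. x m / (x m - x i) * ?A i * (x i / (x i - z)))
      + x m / (x m - z) * (\<Sum>i\<in>I. ?A i * (x i / (x i - x m)))"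
    unfolding sum_distrib_left sum.distrib[symmetric]
  proof (intro sum.cong refl)
    fix i assume i: "i \<in> I"
    show "?A i * (x m / (x m - z) * (x i / (x i - z))) =
        x m / (x m - x i) * ?A i * (x i / (x i - z)) + x m / (x m - z) * (?A i * (x i / (x i - x m)))"
      unfolding split[OF i] by (simp only: distrib_left mult_ac)
  qed
  also have "(\<Sum>i\<in>I. ?A i * (x i / (x i - x m))) = (\<Prod>i\<in>I. x i / (x i - x m))"
    using insert.IH[OF inj mI] by simp
  also have "(\<Sum>i\<in>I. x m / (x m - x i) * ?A i * (x i / (x i - z))) =
      (\<Sum>i\<in>I. (\<Prod>j\<in>insert m I - {i}. x j / (x j - x i)) * (x i / (x i - z)))"
  proof (intro sum.cong refl)
    fix i assume "i \<in> I"
    then have "insert m I - {i} = insert m (I - {i})" using insert.hyps by auto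
    then show "x m / (x m - x i) * ?A i * (x i / (x i - z)) =
        (\<Prod>j\<in>insert m I - {i}. x j / (x j - x i)) * (x i / (x i - z))"
      using insert.hyps by simp
  qed
  also have "insert m I - {m} = I" using insert.hyps by auto
  then have "(\<Prod>i\<in>I. x i / (x i - x m)) = (\<Prod>j\<in>insert m I - {m}. x j / (x j - x m))" by simp
  finally show ?case using insert.hyps by (simp add: add.commute mult.commute)
qed

text \<open>
  At z = 0 the coefficients add up to 1.  The subtraction makes the terms summable uniformly in
  the number of factors.
\<close>
corollary inverse_product_partial_fractions_subtracted:
  fixes x :: "'a \<Rightarrow> 'b :: field"
  assumes "finite I" "I \<noteq> {}" "inj_on x I" "z \<notin> x ` I" "0 \<notin> x ` I"
  shows "(\<Prod>i\<in>I. x i / (x i - z)) =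
    1 + (\<Sum>i\<in>I. (\<Prod>j\<in>I - {i}. x j / (x j - x i)) * (z / (x i - z)))"
proof -
  let ?A = "\<lambda>i. \<Prod>j\<in>I - {i}. x j / (x j - x i)"
  have nz: "x i \<noteq> 0" "x i - z \<noteq> 0" if "i \<in> I" for i using that assms by auto
  have "(\<Prod>i\<in>I. x i / (x i - 0)) = 1" using nz by (intro prod.neutral) auto
  then have 1: "(\<Sum>i\<in>I. ?A i) = 1"
    unfolding inverse_product_partial_fractions[OF assms(1-3,5)] using nz
    by (subst (asm) sum.cong[OF refl, where h = ?A]) auto
  have "(\<Prod>i\<in>I. x i / (x i - z)) = (\<Sum>i\<in>I. ?A i + ?A i * (z / (x i - z)))"
    unfolding inverse_product_partial_fractions[OF assms(1-4)]
  proof (intro sum.cong refl)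
    fix i assume "i \<in> I"
    then have "x i / (x i - z) = 1 + z / (x i - z)" using nz by (simp add: field_simps)
    then show "?A i * (x i / (x i - z)) = ?A i + ?A i * (z / (x i - z))" by (simp only: distrib_left mult_1_right)
  qed
  then show ?thesis by (simp add: sum.distrib 1)
qed

text \<open>
  For k \<le> N this is (N!)^2 / ((N - k)! (N + k)!); in product form the bound by 1 and the
  limit for large N are immediate.
\<close>
definition square_weight :: "nat \<Rightarrow> nat \<Rightarrow> real" where
  "square_weight k N = (\<Prod>i<k. (real N - real i) / (real N + real i + 1))"

lemma square_weight_fact:
  "k \<le> N \<Longrightarrow> square_weight k N * (fact (N - k) * fact (N + k)) = (fact N)\<^sup>2"
proof (induction k)
  case 0
  then show ?case by (simp add: square_weight_def power2_eq_square)
next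
  case (Suc k)
  then have "N - k = Suc (N - Suc k)" by simp
  then have 1: "(fact (N - k) :: real) = (real N - real k) * fact (N - Suc k)"
    using Suc.prems by (simp add: of_nat_diff)
  have 2: "square_weight (Suc k) N = square_weight k N * ((real N - real k) / (real N + real k + 1))"
    by (simp add: square_weight_def)
  have 3: "(fact (N + Suc k) :: real) = (real N + real k + 1) * fact (N + k)" by (simp add: algebra_simps)
  have alg: "W * (p / q) * (f * (q * g)) = W * ((p * f) * g)" if "q \<noteq> 0" for W p q f g :: real
    using that by simp
  have "real N + real k + 1 \<noteq> 0" by linarith
  then have "square_weight (Suc k) N * (fact (N - Suc k) * fact (N + Suc k)) =
      square_weight k N * (fact (N - k) * fact (N + k))"
    unfolding 1 2 3 by (rule alg)
  then show ?case using Suc by simp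
qed

lemma square_weight_bounds: "k \<le> N \<Longrightarrow> 0 \<le> square_weight k N \<and> square_weight k N \<le> 1"
  unfolding square_weight_def by (intro conjI prod_nonneg prod_le_1) auto

lemma square_weight_tendsto: "(\<lambda>N. square_weight k N) \<longlonglongrightarrow> 1"
proof -
  have "(\<lambda>N. (real N - real i) / (real N + real i + 1)) \<longlonglongrightarrow> 1" for i
    by real_asymp
  then have "(\<lambda>N. square_weight k N) \<longlonglongrightarrow> (\<Prod>i<k. 1)"
    unfolding square_weight_def by (intro tendsto_prod)
  then show ?thesis by simp
qed

text \<open>
  The factors with j < k of the k-th coefficient; the factorials come from j^2 - k^2 = - (k - j)
  (k + j).
\<close>
lemma square_product_below:
  assumes "k \<ge> 1" "m < k"
  shows "(\<Prod>j=1..m. (real j)\<^sup>2 / ((real j)\<^sup>2 - (real k)\<^sup>2)) * (fact (k + m) * fact (k - 1)) =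
    (-1) ^ m * (fact m)\<^sup>2 * fact (k - 1 - m) * fact k"
  using assms(2)
proof (induction m)
  case 0
  then show ?case by simp
next
  case (Suc m)
  let ?P = "\<Prod>j=1..m. (real j)\<^sup>2 / ((real j)\<^sup>2 - (real k)\<^sup>2)"
  have "k - 1 - m = Suc (k - 1 - Suc m)" using Suc.prems by simp
  then have 1: "(fact (k - 1 - m) :: real) = (real k - real (Suc m)) * fact (k - 1 - Suc m)"
    using Suc.prems by (simp add: of_nat_diff)
  have 2: "(fact (k + Suc m) :: real) = (real k + real (Suc m)) * fact (k + m)" by (simp add: algebra_simps)
  have 3: "(real (Suc m))\<^sup>2 - (real k)\<^sup>2 = - ((real k - real (Suc m)) * (real k + real (Suc m)))"
    by (simp add: algebra_simps power2_eq_square)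
  have nz: "real k - real (Suc m) \<noteq> 0" "real k + real (Suc m) \<noteq> 0" using Suc.prems by auto
  have alg: "P * (s / - (p * q)) * (q * f * g) = P * (f * g) * (- s / p)" if "q \<noteq> 0" for P s p q f g :: real
    using that by simp
  have "(\<Prod>j=1..Suc m. (real j)\<^sup>2 / ((real j)\<^sup>2 - (real k)\<^sup>2)) * (fact (k + Suc m) * fact (k - 1)) =
     ?P * ((real (Suc m))\<^sup>2 / - ((real k - real (Suc m)) * (real k + real (Suc m)))) * ((real k + real (Suc m)) * fact (k + m) * fact (k - 1))"
    unfolding 2 3[symmetric] by (subst prod.nat_ivl_Suc') auto
  also have "\<dots> = (?P * (fact (k + m) * fact (k - 1))) * (- (real (Suc m))\<^sup>2 / (real k - real (Suc m)))"
    by (rule alg[OF nz(2)])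
  also have "?P * (fact (k + m) * fact (k - 1)) = (-1) ^ m * (fact m)\<^sup>2 * ((real k - real (Suc m)) * fact (k - 1 - Suc m)) * fact k"
    using Suc.IH[OF Suc_lessD[OF Suc.prems]] unfolding 1 .
  also have "\<dots> * (- (real (Suc m))\<^sup>2 / (real k - real (Suc m))) = (-1) ^ Suc m * (fact (Suc m))\<^sup>2 * fact (k - 1 - Suc m) * fact k"
    using nz(1) by (simp add: power_mult_distrib)
  finally show ?case .
qed

text \<open>
  The base case N = k is the preceding product; each further factor multiplies both factorials
  by its linear factors.
\<close>
lemma square_product_fact:
  assumes "k \<ge> 1" "k \<le> N"
  shows "(\<Prod>j\<in>{1..N} - {k}. (real j)\<^sup>2 / ((real j)\<^sup>2 - (real k)\<^sup>2)) * (fact (N - k) * fact (N + k)) =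
    2 * (-1) ^ (k - 1) * (fact N)\<^sup>2"
  using assms(2)
proof (induction N rule: dec_induct)
  case base
  let ?P = "\<Prod>j=1..k - 1. (real j)\<^sup>2 / ((real j)\<^sup>2 - (real k)\<^sup>2)"
  have "{1..k} - {k} = {1..k - 1}" using assms(1) by auto
  moreover have "?P * (fact (k + (k - 1)) * fact (k - 1)) = (-1) ^ (k - 1) * (fact (k - 1))\<^sup>2 * fact k"
    using square_product_below[of k "k - 1"] assms(1) by simp
  then have "?P * fact (k + (k - 1)) = (-1) ^ (k - 1) * fact (k - 1) * fact k"
    by (simp add: power2_eq_square)
  moreover have "(fact (k + k) :: real) = 2 * real k * fact (k + (k - 1))"
    using assms(1) by (cases k) (auto simp: algebra_simps)
  moreover have "(fact k :: real) = real k * fact (k - 1)" using assms(1) by (simp add: fact_reduce)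
  ultimately show ?case by (simp add: power2_eq_square)
next
  case (step N)
  let ?P = "\<lambda>N. \<Prod>j\<in>{1..N} - {k}. (real j)\<^sup>2 / ((real j)\<^sup>2 - (real k)\<^sup>2)"
  have "{1..Suc N} - {k} = insert (Suc N) ({1..N} - {k})" using step by auto
  then have 1: "?P (Suc N) = ?P N * ((real (Suc N))\<^sup>2 / ((real (Suc N))\<^sup>2 - (real k)\<^sup>2))" by simp
  have "Suc N - k = Suc (N - k)" using step by simp
  then have 2: "(fact (Suc N - k) :: real) = (real (Suc N) - real k) * fact (N - k)"
    using step by (simp add: of_nat_diff)
  have 3: "(fact (Suc N + k) :: real) = (real (Suc N) + real k) * fact (N + k)" by (simp add: algebra_simps)
  have 4: "(real (Suc N))\<^sup>2 - (real k)\<^sup>2 = (real (Suc N) - real k) * (real (Suc N) + real k)"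
    by (simp add: algebra_simps power2_eq_square)
  have nz: "real (Suc N) - real k \<noteq> 0" "real (Suc N) + real k \<noteq> 0" using step by auto
  have alg: "P * (s / (p * q)) * (p * f * (q * g)) = P * (f * g) * s" if "p \<noteq> 0" "q \<noteq> 0" for P s p q f g :: real
    using that by simp
  have "?P (Suc N) * (fact (Suc N - k) * fact (Suc N + k)) = (?P N * (fact (N - k) * fact (N + k))) * (real (Suc N))\<^sup>2"
    unfolding 1 2 3 4 by (rule alg[OF nz])
  also have "\<dots> = 2 * (-1) ^ (k - 1) * (fact (Suc N))\<^sup>2"
    unfolding step.IH by (simp add: power2_eq_square algebra_simps)
  finally show ?case .
qed

lemma square_product_eq:
  assumes "k \<ge> 1" "k \<le> N"
  shows "(\<Prod>j\<in>{1..N} - {k}. (real j)\<^sup>2 / ((real j)\<^sup>2 - (real k)\<^sup>2)) = 2 * (-1) ^ (k - 1) * square_weight k N"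
proof -
  have "(\<Prod>j\<in>{1..N} - {k}. (real j)\<^sup>2 / ((real j)\<^sup>2 - (real k)\<^sup>2)) * (fact (N - k) * fact (N + k)) =
    2 * (-1) ^ (k - 1) * square_weight k N * (fact (N - k) * fact (N + k))"
    unfolding square_product_fact[OF assms] square_weight_fact[OF assms(2), symmetric] by simp
  then show ?thesis by simp
qed

lemma summable_inverse_square_shift:
  "summable (\<lambda>k. 2 * cmod z / cmod ((of_nat (Suc k))\<^sup>2 - z))"
proof (rule summable_comparison_test_ev)
  have "filterlim (\<lambda>k. (real (Suc k))\<^sup>2) at_top sequentially" by real_asymp
  then have "eventually (\<lambda>k. 2 * cmod z \<le> (real (Suc k))\<^sup>2) sequentially"
    by (simp add: filterlim_at_top)
  then show "eventually (\<lambda>k. norm (2 * cmod z / cmod ((of_nat (Suc k))\<^sup>2 - z)) \<le>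
      4 * cmod z * (1 / (real (Suc k))\<^sup>2)) sequentially"
  proof eventually_elim
    case (elim k)
    have "(real (Suc k))\<^sup>2 - cmod z \<le> cmod ((of_nat (Suc k))\<^sup>2 - z)"
      using norm_triangle_ineq2[of "(of_nat (Suc k))\<^sup>2" z] by (simp only: norm_power norm_of_nat)
    then have le: "(real (Suc k))\<^sup>2 / 2 \<le> cmod ((of_nat (Suc k))\<^sup>2 - z)" using elim by simp
    have "2 * cmod z / cmod ((of_nat (Suc k))\<^sup>2 - z) \<le> 2 * cmod z / ((real (Suc k))\<^sup>2 / 2)"
      by (intro divide_left_mono le mult_pos_pos) (use le in \<open>auto intro!: order.strict_trans2[OF _ le] simp del: of_nat_Suc\<close>)
    then show ?case by simp
  qed
  have "summable (\<lambda>k. 1 / (real (Suc k))\<^sup>2)"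
    using inverse_power_summable[of 2, where 'a = real] by (subst summable_Suc_iff) (simp add: divide_inverse)
  then show "summable (\<lambda>k. 4 * cmod z * (1 / (real (Suc k))\<^sup>2))" by (rule summable_mult)
qed

text \<open>
  The finite product 1 / \<Prod>(1 - w^2 / k^2) tends to \<pi> w / sin (\<pi> w) by the product
  formula of Euler.  Its partial fraction coefficients are 2 (-1)^(k-1) times weights that are
  bounded by 1 and tend to 1, so the limit can be taken term by term.
\<close>
lemma sin_partial_fractions:
  fixes w :: complex
  assumes "w\<^sup>2 \<notin> range (\<lambda>n. (of_nat (Suc n))\<^sup>2)" "w \<noteq> 0"
  shows "1 + (\<Sum>k. 2 * (-1) ^ k * w\<^sup>2 / ((of_nat (Suc k))\<^sup>2 - w\<^sup>2)) = of_real pi * w / sin (of_real pi * w)"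
    and "sin (of_real pi * w) \<noteq> 0"
proof -
  let ?z = "w\<^sup>2"
  have nz: "(of_nat k)\<^sup>2 \<noteq> ?z" if "k \<ge> 1" for k :: nat
    using assms(1) that by (metis Suc_le_D One_nat_def rangeI)
  show sin0: "sin (of_real pi * w) \<noteq> 0"
  proof
    assume "sin (of_real pi * w) = 0"
    then obtain n :: int where "of_real pi * w = of_real (of_int n * pi)"
      unfolding sin_eq_0 by auto
    then have "w = of_int n" by (simp add: mult.commute)
    moreover then have "n \<noteq> 0" using assms(2) by auto
    moreover have "w\<^sup>2 = (of_nat (nat \<bar>n\<bar>))\<^sup>2"
      unfolding \<open>w = of_int n\<close> by (simp flip: of_int_power)
    moreover have "nat \<bar>n\<bar> \<ge> 1" if "n \<noteq> 0" using that by linarith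
    ultimately show False using nz[of "nat \<bar>n\<bar>"] by metis
  qed
  \<comment> \<open>The summands for N factors, extended by 0 beyond the N-th so that the sums run over all k.\<close>
  define f where "f k N = (if Suc k \<le> N then of_real (2 * (-1) ^ k * square_weight (Suc k) N) * (?z / ((of_nat (Suc k))\<^sup>2 - ?z)) else 0)"
    for k N
  have fsum: "(\<Prod>k=1..N. (of_nat k)\<^sup>2 / ((of_nat k)\<^sup>2 - ?z)) = 1 + (\<Sum>k. f k N)" if "N \<ge> 1" for N
  proof -
    have inj: "inj_on (\<lambda>k. (of_nat k :: complex)\<^sup>2) {1..N}"
    proof (rule inj_onI)
      fix i j :: nat assume "(of_nat i :: complex)\<^sup>2 = (of_nat j)\<^sup>2"
      then have "(of_nat (i\<^sup>2) :: complex) = of_nat (j\<^sup>2)" by simp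
      then show "i = j" unfolding of_nat_eq_iff by simp
    qed
    have "(\<Prod>k=1..N. (of_nat k)\<^sup>2 / ((of_nat k)\<^sup>2 - ?z)) =
      1 + (\<Sum>k=1..N. (\<Prod>j\<in>{1..N} - {k}. (of_nat j)\<^sup>2 / ((of_nat j)\<^sup>2 - (of_nat k)\<^sup>2)) * (?z / ((of_nat k)\<^sup>2 - ?z)))"
      by (rule inverse_product_partial_fractions_subtracted[OF _ _ inj]) (use nz[symmetric] that in \<open>auto simp: image_iff\<close>)
    also have "(\<Sum>k=1..N. (\<Prod>j\<in>{1..N} - {k}. (of_nat j)\<^sup>2 / ((of_nat j)\<^sup>2 - (of_nat k)\<^sup>2)) * (?z / ((of_nat k)\<^sup>2 - ?z))) =
      (\<Sum>k=1..N. f (k - 1) N)"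
    proof (intro sum.cong refl)
      fix k assume k: "k \<in> {1..N}"
      have "(\<Prod>j\<in>{1..N} - {k}. (of_nat j)\<^sup>2 / ((of_nat j)\<^sup>2 - (of_nat k)\<^sup>2)) =
        complex_of_real (\<Prod>j\<in>{1..N} - {k}. (real j)\<^sup>2 / ((real j)\<^sup>2 - (real k)\<^sup>2))" by simp
      also have "\<dots> = of_real (2 * (-1) ^ (k - 1) * square_weight k N)"
        using k by (subst square_product_eq) auto
      finally show "(\<Prod>j\<in>{1..N} - {k}. (of_nat j)\<^sup>2 / ((of_nat j)\<^sup>2 - (of_nat k)\<^sup>2)) * (?z / ((of_nat k)\<^sup>2 - ?z)) = f (k - 1) N"
        using k by (simp add: f_def)
    qed
    also have "\<dots> = (\<Sum>k<N. f k N)"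
      by (rule sum.reindex_bij_witness[of _ Suc "\<lambda>k. k - 1"]) auto
    also have "\<dots> = (\<Sum>k. f k N)"
      by (rule suminf_finite[symmetric]) (auto simp: f_def)
    finally show ?thesis .
  qed
  have "(\<lambda>N. \<Sum>k. f k N) \<longlonglongrightarrow> (\<Sum>k. 2 * (-1) ^ k * ?z / ((of_nat (Suc k))\<^sup>2 - ?z))"
  proof (rule conjunct2[OF conjunct2[OF tannerys_theorem[OF _ _ summable_inverse_square_shift[of ?z]]]])
    fix k
    have "(\<lambda>N. of_real (2 * (-1) ^ k * square_weight (Suc k) N) * (?z / ((of_nat (Suc k))\<^sup>2 - ?z)))
      \<longlonglongrightarrow> of_real (2 * (-1) ^ k * 1) * (?z / ((of_nat (Suc k))\<^sup>2 - ?z))"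
      by (intro tendsto_intros square_weight_tendsto)
    moreover have "eventually (\<lambda>N. of_real (2 * (-1) ^ k * square_weight (Suc k) N) * (?z / ((of_nat (Suc k))\<^sup>2 - ?z)) = f k N) sequentially"
      using eventually_ge_at_top[of "Suc k"] by eventually_elim (simp add: f_def)
    ultimately have "(\<lambda>N. f k N) \<longlonglongrightarrow> of_real (2 * (-1) ^ k * 1) * (?z / ((of_nat (Suc k))\<^sup>2 - ?z))"
      by (rule Lim_transform_eventually)
    then show "(\<lambda>N. f k N) \<longlonglongrightarrow> 2 * (-1) ^ k * ?z / ((of_nat (Suc k))\<^sup>2 - ?z)" by simp
  next
    have "norm (f k N) \<le> 2 * cmod ?z / cmod ((of_nat (Suc k))\<^sup>2 - ?z)" for k N
    proof (cases "Suc k \<le> N")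
      case True
      have "norm (f k N) = 2 * square_weight (Suc k) N * (cmod ?z / cmod ((of_nat (Suc k))\<^sup>2 - ?z))"
        using True square_weight_bounds[OF True]
        by (simp add: f_def norm_mult norm_divide norm_power del: of_nat_Suc)
      also have "\<dots> \<le> 2 * 1 * (cmod ?z / cmod ((of_nat (Suc k))\<^sup>2 - ?z))"
        using square_weight_bounds[OF True] by (intro mult_right_mono mult_left_mono) auto
      finally show ?thesis by simp
    qed (simp add: f_def)
    then show "eventually (\<lambda>(k, N). norm (f k N) \<le> 2 * cmod ?z / cmod ((of_nat (Suc k))\<^sup>2 - ?z)) (at_top \<times>\<^sub>F sequentially)"
      by (intro always_eventually) auto
  qed simp
  then have "(\<lambda>N. 1 + (\<Sum>k. f k N)) \<longlonglongrightarrow> 1 + (\<Sum>k. 2 * (-1) ^ k * ?z / ((of_nat (Suc k))\<^sup>2 - ?z))"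
    by (intro tendsto_intros)
  moreover have "(\<lambda>N. 1 + (\<Sum>k. f k N)) \<longlonglongrightarrow> of_real pi * w / sin (of_real pi * w)"
  proof -
    have "(\<lambda>N. of_real pi * w / (of_real pi * w * (\<Prod>k=1..N. 1 - w\<^sup>2 / (of_nat k)\<^sup>2))) \<longlonglongrightarrow> of_real pi * w / sin (of_real pi * w)"
      by (intro tendsto_intros sin_product_formula_complex sin0)
    moreover have "eventually (\<lambda>N. of_real pi * w / (of_real pi * w * (\<Prod>k=1..N. 1 - w\<^sup>2 / (of_nat k)\<^sup>2)) = 1 + (\<Sum>k. f k N)) sequentially"
      using eventually_ge_at_top[of 1]
    proof eventually_elim
      case (elim N)
      have "of_real pi * w / (of_real pi * w * (\<Prod>k=1..N. 1 - w\<^sup>2 / (of_nat k)\<^sup>2)) = (\<Prod>k=1..N. inverse (1 - w\<^sup>2 / (of_nat k)\<^sup>2))"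
        unfolding prod_inversef[unfolded o_def] using assms(2) by (simp add: field_simps)
      also have "\<dots> = (\<Prod>k=1..N. (of_nat k)\<^sup>2 / ((of_nat k)\<^sup>2 - ?z))"
        by (intro prod.cong refl) (auto simp: divide_simps)
      finally show ?case using fsum[OF elim] by simp
    qed
    ultimately show ?thesis by (rule Lim_transform_eventually)
  qed
  ultimately show "1 + (\<Sum>k. 2 * (-1) ^ k * ?z / ((of_nat (Suc k))\<^sup>2 - ?z)) = of_real pi * w / sin (of_real pi * w)"
    by (rule LIMSEQ_unique)
qed

section \<open>The squares form a removable spectrum\<close>

lemma spectral_sequence_squares: "spectral_sequence (\<lambda>n. (real (Suc n))\<^sup>2)"
proof -
  have "filterlim (\<lambda>n. \<bar>(real (Suc n))\<^sup>2\<bar>) at_top sequentially" by real_asymp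
  moreover have "inj (\<lambda>n. (real (Suc n))\<^sup>2)" by (auto simp: inj_def power2_eq_iff_nonneg)
  ultimately show ?thesis by (simp add: spectral_sequence_def)
qed

text \<open>
  With c n = 2 (-1)^n (n+1)^2 and \<kappa> = 1 the coupling function at z = w^2 is \<pi> w / sin
  (\<pi> w), continued by 1 at w = 0, which never vanishes.
\<close>
lemma squares_removable:
  assumes "\<And>n. w n > 0"
  shows "removable (\<lambda>n. (real (Suc n))\<^sup>2) w" (is "removable ?t w")
proof -
  define c where "c n = (2 * (-1) ^ n * (of_nat (Suc n))\<^sup>2 :: complex)" for n
  have c: "cmod (c n) = 2 * (real (Suc n))\<^sup>2" for n
    by (simp add: c_def norm_mult norm_power del: of_nat_Suc)
  have s2: "summable (\<lambda>n. 2 * (1 / (real (Suc n))\<^sup>2))"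
    using inverse_power_summable[of 2, where 'a = real]
    by (intro summable_mult) (subst summable_Suc_iff, simp add: divide_inverse)
  show "removable ?t w"
  proof (rule coupling_imp_removable[OF spectral_sequence_squares assms, where c = c and \<kappa> = 1])
    fix n show "c n \<noteq> 0" by (simp add: c_def del: of_nat_Suc)
  next
    have "cmod (c n) / ((real (Suc n))\<^sup>2)\<^sup>2 = 2 * (1 / (real (Suc n))\<^sup>2)" for n
      by (simp add: c power2_eq_square del: of_nat_Suc)
    then show "summable (\<lambda>n. cmod (c n) / ((real (Suc n))\<^sup>2)\<^sup>2)" using s2 by simp
    show "\<not> summable (\<lambda>n. cmod (c n))"
    proof
      assume "summable (\<lambda>n. cmod (c n))"
      then have "(\<lambda>n. 2 * (real (Suc n))\<^sup>2) \<longlonglongrightarrow> 0" unfolding c by (rule summable_LIMSEQ_zero)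
      moreover have "2 \<le> 2 * (real (Suc n))\<^sup>2" for n by simp
      ultimately have "(2 :: real) \<le> 0" using LIMSEQ_le_const by blast
      then show False by simp
    qed
  next
    fix z assume z: "z \<notin> range (\<lambda>n. complex_of_real ((real (Suc n))\<^sup>2))"
    define w where "w = csqrt z"
    have w: "z = w\<^sup>2" by (simp add: w_def)
    have eq: "coupling_function ?t c 1 z = 1 + (\<Sum>k. 2 * (-1) ^ k * w\<^sup>2 / ((of_nat (Suc k))\<^sup>2 - w\<^sup>2))"
      unfolding coupling_function_def w
      by (intro arg_cong[where f = "\<lambda>x. 1 + x"] suminf_cong) (simp add: c_def del: of_nat_Suc)
    show "coupling_function ?t c 1 z \<noteq> 0"
    proof (cases "w = 0")
      case True
      then show ?thesis unfolding eq by simp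
    next
      case False
      moreover have "w\<^sup>2 \<notin> range (\<lambda>n. (of_nat (Suc n))\<^sup>2)" using z unfolding w by (auto simp del: of_nat_Suc)
      ultimately show ?thesis unfolding eq using sin_partial_fractions[of w] by simp
    qed
  qed
qed

section \<open>Entire functions attached to a perturbation\<close>

text \<open>
  H = exp h with h entire, and the real part of u = h - h 0 on the disc of radius r n is below
  some A n = o(r n).  Then u / (2 A n - u) maps this disc into the unit disc and fixes 0, and by
  the Schwarz lemma |u z| is at most of order A n |z| / r n, which tends to 0.
\<close>
lemma zero_free_entire_small_growth_constant:
  assumes H: "H holomorphic_on UNIV" "\<And>z. H z \<noteq> 0"
    and r: "filterlim r at_top sequentially"
    and bound: "\<And>n z. cmod z = r n \<Longrightarrow> cmod (H z) \<le> exp (m n)"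
    and growth: "(\<lambda>n. m n / r n) \<longlonglongrightarrow> 0"
  shows "H z = H 0"
proof -
  obtain h where h: "h holomorphic_on UNIV" "\<And>z. exp (h z) = H z"
    using holomorphic_logarithm_exists[of UNIV H 0] H by auto
  define u where "u z = h z - h 0" for z
  \<comment> \<open>The summand 1 makes the bound on Re u strict, so that u / (2 A - u) has modulus less than 1.\<close>
  define A where "A n = \<bar>m n\<bar> + \<bar>Re (h 0)\<bar> + 1" for n
  have "A n > 0" for n by (simp add: A_def add_nonneg_pos)
  have Re_le: "Re (u \<zeta>) < A n" if "cmod \<zeta> \<le> r n" "r n > 0" for \<zeta> n
  proof -
    have "cmod (H \<zeta>) \<le> exp (m n)"
    proof (rule maximum_modulus_frontier[of H "cball 0 (r n)"])
      show "H holomorphic_on interior (cball 0 (r n))" "continuous_on (closure (cball 0 (r n))) H"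
        using H(1) by (auto intro: holomorphic_on_subset holomorphic_on_imp_continuous_on)
    qed (use that bound in auto)
    then have "exp (Re (h \<zeta>)) \<le> exp (m n)" using h(2)[of \<zeta>] by (metis norm_exp_eq_Re)
    then show ?thesis by (simp add: u_def A_def)
  qed
  have key: "cmod (u z) * (1 - cmod z / r n) \<le> 2 * cmod z * (A n / r n)" if n: "r n > cmod z" for n
  proof -
    have r0: "r n > 0" using n norm_ge_zero[of z] by linarith
    define \<phi> where "\<phi> \<zeta> = u (of_real (r n) * \<zeta>) / (2 * of_real (A n) - u (of_real (r n) * \<zeta>))" for \<zeta>
    have Re_lt: "Re (u (of_real (r n) * \<zeta>)) < A n" if "cmod \<zeta> < 1" for \<zeta>
      using that r0 by (intro Re_le) (auto simp: norm_mult)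
    have nz: "2 * of_real (A n) - u (of_real (r n) * \<zeta>) \<noteq> 0" if "cmod \<zeta> < 1" for \<zeta>
      using Re_lt[OF that] \<open>A n > 0\<close> by (auto simp: complex_eq_iff)
    have "cmod (\<phi> (z / of_real (r n))) \<le> cmod (z / of_real (r n))"
    proof (rule Schwarz_Lemma(1))
      have "u holomorphic_on UNIV" unfolding u_def by (intro holomorphic_intros h)
      then have "u \<circ> (\<lambda>\<zeta>. of_real (r n) * \<zeta>) holomorphic_on ball 0 1"
        by (intro holomorphic_on_compose holomorphic_intros) (auto intro: holomorphic_on_subset)
      then show "\<phi> holomorphic_on ball 0 1"
        unfolding \<phi>_def o_def using nz by (intro holomorphic_intros) auto
      show "\<phi> 0 = 0" by (simp add: \<phi>_def u_def)
      show "cmod (z / of_real (r n)) < 1" using n r0 by (simp add: norm_divide)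
    next
      fix \<zeta> :: complex assume \<zeta>: "cmod \<zeta> < 1"
      let ?v = "u (of_real (r n) * \<zeta>)"
      \<comment> \<open>The point ?v lies closer to 0 than to its mirror point 2 A, because Re ?v < A.\<close>
      have "(cmod (2 * of_real (A n) - ?v))\<^sup>2 - (cmod ?v)\<^sup>2 = 4 * A n * (A n - Re ?v)"
        unfolding cmod_power2 by (simp add: power2_eq_square algebra_simps)
      also have "\<dots> > 0" using Re_lt[OF \<zeta>] \<open>A n > 0\<close> by simp
      finally have "cmod ?v < cmod (2 * of_real (A n) - ?v)"
        by (intro power_less_imp_less_base[of "cmod ?v" 2]) auto
      then show "cmod (\<phi> \<zeta>) < 1" using nz[OF \<zeta>] by (simp add: \<phi>_def norm_divide divide_less_eq)
    qed
    moreover have "\<phi> (z / of_real (r n)) = u z / (2 * of_real (A n) - u z)"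
      using r0 by (simp add: \<phi>_def)
    moreover have "2 * of_real (A n) - u z \<noteq> 0"
      using nz[of "z / of_real (r n)"] n r0 by (simp add: norm_divide)
    ultimately have "cmod (u z) \<le> cmod z / r n * cmod (2 * of_real (A n) - u z)"
      using r0 by (simp add: norm_divide pos_divide_le_eq)
    also have "cmod (2 * of_real (A n) - u z) \<le> 2 * A n + cmod (u z)"
      using norm_triangle_ineq4[of "2 * of_real (A n)" "u z"] \<open>A n > 0\<close> by (simp add: norm_mult)
    then have "cmod z / r n * cmod (2 * of_real (A n) - u z) \<le> cmod z / r n * (2 * A n + cmod (u z))"
      using r0 by (intro mult_left_mono) auto
    finally show ?thesis by (simp add: algebra_simps)
  qed
  have inv: "(\<lambda>n. k / r n) \<longlonglongrightarrow> 0" for k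
    by (rule tendsto_divide_0[OF tendsto_const filterlim_at_top_imp_at_infinity[OF r]])
  have ev0: "eventually (\<lambda>n. r n > 0) sequentially" using r by (simp add: filterlim_at_top_dense)
  have "(\<lambda>n. \<bar>m n / r n\<bar> + (\<bar>Re (h 0)\<bar> + 1) / r n) \<longlonglongrightarrow> 0 + 0"
    by (intro tendsto_add inv tendsto_rabs_zero growth)
  moreover have "eventually (\<lambda>n. \<bar>m n / r n\<bar> + (\<bar>Re (h 0)\<bar> + 1) / r n = A n / r n) sequentially"
    using ev0 by eventually_elim (simp add: A_def add_divide_distrib)
  ultimately have "(\<lambda>n. A n / r n) \<longlonglongrightarrow> 0 + 0" by (rule Lim_transform_eventually)
  then have "(\<lambda>n. 2 * cmod z * (A n / r n)) \<longlonglongrightarrow> 2 * cmod z * (0 + 0)" by (rule tendsto_mult_left)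
  moreover have "(\<lambda>n. cmod (u z) * (1 - cmod z / r n)) \<longlonglongrightarrow> cmod (u z) * (1 - 0)"
    by (intro tendsto_intros inv)
  moreover have "eventually (\<lambda>n. cmod (u z) * (1 - cmod z / r n) \<le> 2 * cmod z * (A n / r n)) sequentially"
    using r[unfolded filterlim_at_top_dense, rule_format, of "cmod z"] by eventually_elim (rule key)
  ultimately have "cmod (u z) * (1 - 0) \<le> 2 * cmod z * (0 + 0)"
    by (intro tendsto_le[OF sequentially_bot])
  then have "h z = h 0" by (simp add: u_def)
  then show ?thesis using h(2) by metis
qed

text \<open>
  The zeros of G at the s n cancel the poles of the coupling function: each quotient G z / (z -
  s n) is extended over s n, and the series of the extended terms converges locally uniformly,
  because |G z| / |z - s n| is at most 2 |G z| / |s n| once |s n| is large.  At s k only the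
  k-th term survives.
\<close>
lemma entire_multiple_of_coupling_function:
  fixes s :: "nat \<Rightarrow> real"
  assumes s: "spectral_sequence s" and c: "summable (\<lambda>n. cmod (c n) / (s n)\<^sup>2)"
    and G: "G holomorphic_on UNIV" "\<And>n. G (of_real (s n)) = 0"
  obtains H where "H holomorphic_on UNIV"
    "\<And>z. z \<notin> range (\<lambda>n. complex_of_real (s n)) \<Longrightarrow> H z = G z * coupling_function s c \<kappa> z"
    "\<And>k. H (of_real (s k)) = - c k * deriv G (of_real (s k))"
proof -
  have inj: "inj s" and s0 [simp]: "s n \<noteq> 0" and lim: "filterlim (\<lambda>n. \<bar>s n\<bar>) at_top sequentially" for n
    using s by (auto simp: spectral_sequence_def)
  define p where "p n z = (if z = of_real (s n) then deriv G (of_real (s n))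
      else (G z - G (of_real (s n))) / (z - of_real (s n)))" for n and z :: complex
  \<comment> \<open>The n-th term of G z times the coupling series, with its pole at s n removed.\<close>
  define f where "f n z = - (c n / of_real (s n)) * z * p n z" for n z
  have f_hol: "f n holomorphic_on UNIV" for n
    unfolding f_def p_def by (intro holomorphic_intros pole_lemma_open G) auto
  have dominated: "\<exists>d h. 0 < d \<and> summable h \<and> range h \<subseteq> \<real>\<^sub>\<ge>\<^sub>0 \<and>
      (\<forall>\<^sub>F n in sequentially. \<forall>y\<in>ball x d \<inter> UNIV. cmod (f n y) \<le> cmod (h n))" for x
  proof -
    define R where "R = cmod x + 1"
    have R: "R > 0" by (simp add: R_def add_nonneg_pos)
    have "bounded (G ` cball x 1)"
      using G(1) by (intro compact_imp_bounded compact_continuous_image holomorphic_on_imp_continuous_on)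
        (auto intro: holomorphic_on_subset)
    then obtain B where B: "\<And>y. y \<in> cball x 1 \<Longrightarrow> cmod (G y) \<le> B" "B > 0"
      unfolding bounded_pos by (metis image_eqI)
    define h where "h n = 2 * B * R * (cmod (c n) / (s n)\<^sup>2)" for n
    have "eventually (\<lambda>n. 2 * R \<le> \<bar>s n\<bar>) sequentially" using lim by (simp add: filterlim_at_top)
    then have "\<forall>\<^sub>F n in sequentially. \<forall>y\<in>ball x 1. cmod (f n y) \<le> h n"
    proof eventually_elim
      case (elim n)
      show ?case
      proof
        fix y assume y: "y \<in> ball x 1"
        have "cmod y \<le> cmod x + cmod (x - y)" using norm_triangle_ineq4[of x "x - y"] by simp
        then have yR: "cmod y \<le> R" using y by (simp add: R_def dist_norm)
        have "\<bar>s n\<bar> - cmod y \<le> cmod (y - of_real (s n))"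
          using norm_triangle_ineq2[of "of_real (s n)" y] by (simp add: norm_minus_commute)
        then have d: "\<bar>s n\<bar> / 2 \<le> cmod (y - of_real (s n))" using yR elim by linarith
        then have "y \<noteq> of_real (s n)" by auto
        then have "cmod (p n y) = cmod (G y) / cmod (y - of_real (s n))"
          by (simp add: p_def G(2) norm_divide)
        also have "\<dots> \<le> B / (\<bar>s n\<bar> / 2)"
          using y B d by (intro frac_le) auto
        finally have pb: "cmod (p n y) \<le> B / (\<bar>s n\<bar> / 2)" .
        have "cmod (f n y) = cmod (c n) / \<bar>s n\<bar> * cmod y * cmod (p n y)"
          by (simp add: f_def norm_mult norm_divide)
        also have "\<dots> \<le> cmod (c n) / \<bar>s n\<bar> * R * (B / (\<bar>s n\<bar> / 2))"
          using yR pb R by (intro mult_mono) auto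
        also have "\<dots> = h n" by (simp add: h_def power2_eq_square flip: abs_mult)
        finally show "cmod (f n y) \<le> h n" .
      qed
    qed
    moreover have "h n \<ge> 0" for n unfolding h_def using B R by simp
    moreover have "summable h" unfolding h_def by (intro summable_mult c)
    ultimately show ?thesis
      by (intro exI[of _ 1] exI[of _ "\<lambda>n. of_real (h n)"])
         (auto simp: summable_of_real)
  qed
  have "f n field_differentiable (at x)" for n x
    using f_hol[of n] by (rule holomorphic_on_imp_differentiable_at) auto
  then obtain g where "\<forall>x\<in>UNIV. (\<lambda>n. f n x) sums g x \<and> g field_differentiable (at x)"
    by (rule series_differentiable_comparison_complex[OF open_UNIV _ dominated]) blast
  then have g: "(\<lambda>n. f n x) sums g x" "g field_differentiable (at x)" for x by auto
  define H where "H z = \<kappa> * G z + g z" for z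
  show ?thesis
  proof (rule that[of H])
    have "g holomorphic_on UNIV"
      using g(2) by (auto simp: holomorphic_on_def intro: field_differentiable_at_within)
    then show "H holomorphic_on UNIV" unfolding H_def by (intro holomorphic_intros G)
  next
    fix z assume z: "z \<notin> range (\<lambda>n. complex_of_real (s n))"
    have "f n z = G z * (c n * z / (of_real (s n) * (of_real (s n) - z)))" for n
    proof -
      have "z - of_real (s n) \<noteq> 0" "of_real (s n) - z \<noteq> 0" "z \<noteq> of_real (s n)" using z by auto
      then show ?thesis by (simp add: f_def p_def G(2) divide_simps) (simp add: algebra_simps)
    qed
    then have sm: "(\<lambda>n. G z * (c n * z / (of_real (s n) * (of_real (s n) - z)))) sums g z"
      using g(1)[of z] by simp
    show "H z = G z * coupling_function s c \<kappa> z"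
    proof (cases "G z = 0")
      case True
      then have "g z = 0" using sm by (simp add: sums_iff)
      then show ?thesis using True by (simp add: H_def)
    next
      case False
      then have "(\<lambda>n. c n * z / (of_real (s n) * (of_real (s n) - z))) sums (g z / G z)"
        using sums_mult_iff[OF False, of "\<lambda>n. c n * z / (of_real (s n) * (of_real (s n) - z))" "g z / G z"] sm by simp
      then show ?thesis using False by (simp add: H_def coupling_function_def sums_iff algebra_simps)
    qed
  next
    fix k
    let ?z = "complex_of_real (s k)"
    have "f n ?z = (if n = k then - c k * deriv G ?z else 0)" for n
      using inj by (auto simp: f_def p_def G(2) inj_def)
    then have "(\<lambda>n. if n = k then - c k * deriv G ?z else 0) sums g ?z" using g(1)[of ?z] by simp
    then have "g ?z = - c k * deriv G ?z" using sums_single[of k "\<lambda>_. - c k * deriv G ?z"] sums_unique2 by blast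
    then show "H ?z = - c k * deriv G ?z" by (simp add: H_def G(2))
  qed
qed

text \<open>
  The entire function with sinc_sqrt (w^2) = sin (\<pi> w) / (\<pi> w), given by its power
  series to avoid a branch of the square root.
\<close>
definition sinc_sqrt :: "complex \<Rightarrow> complex" where
  "sinc_sqrt z = (\<Sum>j. (- (of_real pi)\<^sup>2) ^ j / fact (2 * j + 1) * z ^ j)"

lemma sinc_sqrt_series:
  "(\<lambda>j. (- (of_real pi)\<^sup>2) ^ j / fact (2 * j + 1) * (w\<^sup>2) ^ j * (of_real pi * w)) sums sin (of_real pi * w :: complex)"
proof -
  let ?x = "of_real pi * w"
  have "(\<lambda>n. \<Sum>k = n*2..<n * 2 + 2. sin_coeff k *\<^sub>R ?x ^ k) sums sin ?x"
    by (rule sums_group[OF sin_converges]) auto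
  moreover have "(\<Sum>k = n*2..<n * 2 + 2. sin_coeff k *\<^sub>R ?x ^ k) =
      (- (of_real pi)\<^sup>2) ^ n / fact (2 * n + 1) * (w\<^sup>2) ^ n * ?x" for n
  proof -
    have "(\<Sum>k = n*2..<n * 2 + 2. sin_coeff k *\<^sub>R ?x ^ k) = sin_coeff (2 * n + 1) *\<^sub>R ?x ^ (2 * n + 1)"
      by (simp add: sin_coeff_def mult.commute)
    also have "\<dots> = (-1) ^ n / fact (2 * n + 1) * (?x\<^sup>2) ^ n * ?x"
      by (simp add: sin_coeff_def scaleR_conv_of_real power_mult[symmetric])
    also have "\<dots> = (- (of_real pi)\<^sup>2) ^ n / fact (2 * n + 1) * (w\<^sup>2) ^ n * ?x"
      by (simp add: power_mult_distrib power_minus[of "(of_real pi)\<^sup>2"])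
    finally show ?thesis .
  qed
  ultimately show ?thesis by simp
qed

lemma sinc_sqrt_summable: "summable (\<lambda>j. (- (of_real pi)\<^sup>2) ^ j / fact (2 * j + 1) * z ^ j :: complex)"
proof (cases "z = 0")
  case True
  then show ?thesis by (intro summable_finite[of "{0}"]) auto
next
  case False
  then have "of_real pi * csqrt z \<noteq> 0" by simp
  moreover have "summable (\<lambda>j. (- (of_real pi)\<^sup>2) ^ j / fact (2 * j + 1) * z ^ j * (of_real pi * csqrt z))"
    using sums_summable[OF sinc_sqrt_series[of "csqrt z"]] by simp
  ultimately show ?thesis
    by (simp only: mult.commute[of _ "of_real pi * csqrt z"] summable_cmult_iff simp_thms)
qed

lemma sinc_sqrt_square: "sinc_sqrt (w\<^sup>2) * (of_real pi * w) = sin (of_real pi * w)"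
proof -
  have "sinc_sqrt (w\<^sup>2) * (of_real pi * w) =
      (\<Sum>j. (- (of_real pi)\<^sup>2) ^ j / fact (2 * j + 1) * (w\<^sup>2) ^ j * (of_real pi * w))"
    unfolding sinc_sqrt_def by (rule suminf_mult2[OF sinc_sqrt_summable])
  also have "\<dots> = sin (of_real pi * w)" by (rule sums_unique[OF sinc_sqrt_series, symmetric])
  finally show ?thesis .
qed

lemma sinc_sqrt_holomorphic: "sinc_sqrt holomorphic_on UNIV"
proof -
  have "\<exists>f'. (sinc_sqrt has_field_derivative f') (at z)" for z
    unfolding sinc_sqrt_def[abs_def]
    using termdiffs_strong_converges_everywhere[OF sinc_sqrt_summable] by blast
  then show ?thesis by (simp add: holomorphic_on_open)
qed

lemma sinc_sqrt_eq_0_iff: "sinc_sqrt z = 0 \<longleftrightarrow> (\<exists>n. z = (of_nat (Suc n))\<^sup>2)"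
proof
  assume 0: "sinc_sqrt z = 0"
  have "sinc_sqrt 0 = 1" unfolding sinc_sqrt_def by (subst suminf_finite[of "{0}"]) auto
  then have "z \<noteq> 0" using 0 by auto
  define w where "w = csqrt z"
  have w: "z = w\<^sup>2" "w \<noteq> 0" using \<open>z \<noteq> 0\<close> by (auto simp: w_def)
  then have "sin (of_real pi * w) = 0" using sinc_sqrt_square[of w] 0 by simp
  then obtain n :: int where "of_real pi * w = of_real (of_int n * pi)" unfolding sin_eq_0 by auto
  then have wn: "w = of_int n" by (simp add: mult.commute)
  then have "nat \<bar>n\<bar> \<noteq> 0" using w(2) by auto
  then obtain k where "nat \<bar>n\<bar> = Suc k" by (cases "nat \<bar>n\<bar>") auto
  then have k: "\<bar>n\<bar> = int (Suc k)" by linarith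
  have "n\<^sup>2 = (int (Suc k))\<^sup>2" unfolding k[symmetric] by simp
  then have "of_int (n\<^sup>2) = (of_int ((int (Suc k))\<^sup>2) :: complex)" by simp
  then have "z = (of_nat (Suc k))\<^sup>2" by (simp add: w(1) wn del: of_nat_Suc)
  then show "\<exists>n. z = (of_nat (Suc n))\<^sup>2" by blast
next
  assume "\<exists>n. z = (of_nat (Suc n))\<^sup>2"
  then obtain n where n: "z = (of_nat (Suc n))\<^sup>2" by blast
  have "sin (of_real pi * of_nat (Suc n)) = (0 :: complex)"
    unfolding sin_eq_0 by (rule exI[of _ "int (Suc n)"]) (simp add: mult.commute)
  then show "sinc_sqrt z = 0" using sinc_sqrt_square[of "of_nat (Suc n)"] by (simp add: n del: of_nat_Suc)
qed

text \<open>
  Differentiate sinc_sqrt (w^2) * \<pi> w = sin (\<pi> w) at w = n + 1.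
\<close>
lemma cmod_deriv_sinc_sqrt:
  "cmod (deriv sinc_sqrt ((of_nat (Suc n))\<^sup>2)) = 1 / (2 * (real (Suc n))\<^sup>2)"
proof -
  let ?p = "complex_of_nat (Suc n)"
  have d: "(sinc_sqrt has_field_derivative deriv sinc_sqrt (?p\<^sup>2)) (at (?p\<^sup>2))"
    using sinc_sqrt_holomorphic by (simp add: holomorphic_derivI)
  have "((\<lambda>w. sinc_sqrt (w\<^sup>2)) has_field_derivative deriv sinc_sqrt (?p\<^sup>2) * (2 * ?p)) (at ?p)"
    by (rule DERIV_chain2[where f = sinc_sqrt and g = "\<lambda>w. w\<^sup>2", OF d]) (auto intro!: derivative_eq_intros)
  moreover have "((\<lambda>w. of_real pi * w) has_field_derivative of_real pi) (at ?p)"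
    by (auto intro!: derivative_eq_intros)
  ultimately have "((\<lambda>w. sinc_sqrt (w\<^sup>2) * (of_real pi * w)) has_field_derivative
      (deriv sinc_sqrt (?p\<^sup>2) * (2 * ?p)) * (of_real pi * ?p) + of_real pi * sinc_sqrt (?p\<^sup>2)) (at ?p)"
    by (rule DERIV_mult)
  moreover have "sinc_sqrt (?p\<^sup>2) = 0" by (subst sinc_sqrt_eq_0_iff) blast
  ultimately have 1: "((\<lambda>w. sin (of_real pi * w)) has_field_derivative
      deriv sinc_sqrt (?p\<^sup>2) * (2 * ?p\<^sup>2 * of_real pi)) (at ?p)"
    unfolding sinc_sqrt_square by (simp add: power2_eq_square mult_ac del: of_nat_Suc)
  have 2: "((\<lambda>w. sin (of_real pi * w)) has_field_derivative cos (of_real pi * ?p) * of_real pi) (at ?p)"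
    by (rule derivative_eq_intros refl | simp)+
  have "deriv sinc_sqrt (?p\<^sup>2) * (2 * ?p\<^sup>2 * of_real pi) = cos (of_real pi * ?p) * of_real pi"
    by (rule DERIV_unique[OF 1 2])
  then have "deriv sinc_sqrt (?p\<^sup>2) * (2 * ?p\<^sup>2) = cos (of_real (real (Suc n) * pi))"
    by (simp add: mult.commute del: of_nat_Suc)
  also have "\<dots> = of_real ((-1) ^ Suc n)" by (simp only: cos_of_real cos_npi)
  finally have "cmod (deriv sinc_sqrt (?p\<^sup>2) * (2 * ?p\<^sup>2)) = 1" by (simp only: norm_of_real power_abs) simp
  then have "cmod (deriv sinc_sqrt (?p\<^sup>2)) * (2 * (real (Suc n))\<^sup>2) = 1"
    by (simp only: norm_mult norm_power norm_of_nat norm_numeral)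
  then show ?thesis by (simp add: field_simps del: of_nat_Suc)
qed

section \<open>Deleting one square\<close>

text \<open>
  The difference of p^2 and (j + 1/2)^2 factors as (p - j - 1/2) (p + j + 1/2), and the first
  factor has modulus at least 1/2.
\<close>
lemma square_distance:
  fixes p j :: nat and z :: complex
  assumes "cmod z = (real j + 1/2)\<^sup>2"
  shows "cmod (of_real ((real p)\<^sup>2) - z) \<ge> 1/4"
    and "(real p)\<^sup>2 \<le> (2 * real j + 2) * cmod (of_real ((real p)\<^sup>2) - z)"
proof -
  let ?d = "\<bar>real p - (real j + 1/2)\<bar>"
  let ?\<sigma> = "real p + real j + 1/2"
  \<comment> \<open>j + 1/2 lies halfway between two integers.\<close>
  have d: "?d \<ge> 1/2"
  proof (cases "p \<le> j")
    case True
    then have "real p \<le> real j" by simp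
    then show ?thesis by linarith
  next
    case False
    then have "real p \<ge> real j + 1" by linarith
    then show ?thesis by linarith
  qed
  have "?d * ?\<sigma> = \<bar>(real p - (real j + 1/2)) * ?\<sigma>\<bar>" by (simp add: abs_mult)
  also have "\<dots> = \<bar>(real p)\<^sup>2 - (real j + 1/2)\<^sup>2\<bar>" by (simp add: power2_eq_square algebra_simps)
  also have "\<dots> \<le> cmod (of_real ((real p)\<^sup>2) - z)"
    using norm_triangle_ineq3[of "complex_of_real ((real p)\<^sup>2)" z] unfolding assms norm_of_real abs_power2 .
  finally have le: "?d * ?\<sigma> \<le> cmod (of_real ((real p)\<^sup>2) - z)" .
  have "1/2 * (1/2) \<le> ?d * ?\<sigma>" by (intro mult_mono d) auto
  then show "cmod (of_real ((real p)\<^sup>2) - z) \<ge> 1/4" using le by linarith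
  have "real p \<le> ?d + (2 * real j + 1) * (1/2)"
    using abs_ge_self[of "real p - (real j + 1/2)"] by (simp add: field_simps)
  also have "(2 * real j + 1) * (1/2) \<le> (2 * real j + 1) * ?d" by (intro mult_left_mono d) auto
  finally have "real p \<le> (2 * real j + 2) * ?d" by (simp add: algebra_simps)
  then have "real p * real p \<le> ((2 * real j + 2) * ?d) * ?\<sigma>" by (intro mult_mono) auto
  also have "\<dots> \<le> (2 * real j + 2) * cmod (of_real ((real p)\<^sup>2) - z)"
    unfolding mult.assoc by (intro mult_left_mono le) auto
  finally show "(real p)\<^sup>2 \<le> (2 * real j + 2) * cmod (of_real ((real p)\<^sup>2) - z)" by (simp add: power2_eq_square)
qed

text \<open>
  The circles |z| = (j + 1/2)^2 pass between consecutive squares at a distance that keeps all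
  quotients p^2 / |p^2 - z| at most 2 j + 2; so on them the coupling function grows at most
  polynomially.
\<close>
lemma coupling_function_bound:
  assumes c: "summable (\<lambda>n. cmod (c n) / ((real (p n))\<^sup>2)\<^sup>2)"
    and p: "\<And>n. p n > 0" and z: "cmod z = (real j + 1/2)\<^sup>2"
  shows "cmod (coupling_function (\<lambda>n. (real (p n))\<^sup>2) c \<kappa> z) \<le>
    cmod \<kappa> + (\<Sum>n. cmod (c n) / ((real (p n))\<^sup>2)\<^sup>2) * ((real j + 1/2)\<^sup>2 * (2 * real j + 2))"
proof -
  let ?s = "\<lambda>n. (real (p n))\<^sup>2"
  let ?K = "(real j + 1/2)\<^sup>2 * (2 * real j + 2)"
  let ?f = "\<lambda>n. c n * z / (of_real (?s n) * (of_real (?s n) - z))"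
  have le: "norm (?f n) \<le> cmod (c n) / (?s n)\<^sup>2 * ?K" for n
  proof -
    have s: "?s n > 0" using p[of n] by simp
    have d: "cmod (of_real (?s n) - z) > 0"
      using square_distance(1)[OF z, of "p n"] by linarith
    have "?s n / cmod (of_real (?s n) - z) \<le> 2 * real j + 2"
      using square_distance(2)[OF z, of "p n"] d by (simp add: divide_le_eq)
    then have "cmod (c n) / (?s n)\<^sup>2 * ((real j + 1/2)\<^sup>2 * (?s n / cmod (of_real (?s n) - z))) \<le>
      cmod (c n) / (?s n)\<^sup>2 * ?K"
      by (intro mult_left_mono) auto
    moreover have "cmod (c n) / (?s n)\<^sup>2 * ((real j + 1/2)\<^sup>2 * (?s n / cmod (of_real (?s n) - z))) = norm (?f n)"
    proof -
      have "norm (?f n) = cmod (c n) * (real j + 1/2)\<^sup>2 / (?s n * cmod (of_real (?s n) - z))"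
        by (simp only: norm_mult norm_divide z norm_of_real abs_power2)
      moreover have "x / S\<^sup>2 * (y * (S / D)) = x * y / (S * D)" if "S > 0" "D > 0" for x y S D :: real
        using that by (simp add: field_simps power2_eq_square)
      ultimately show ?thesis using s d by presburger
    qed
    ultimately show ?thesis by linarith
  qed
  have sK: "summable (\<lambda>n. cmod (c n) / (?s n)\<^sup>2 * ?K)" by (rule summable_mult2[OF c])
  have sf: "summable (\<lambda>n. norm (?f n))"
    by (rule summable_comparison_test'[OF sK, of 0]) (use le in auto)
  have "norm (\<Sum>n. ?f n) \<le> (\<Sum>n. norm (?f n))" by (rule summable_norm[OF sf])
  also have "\<dots> \<le> (\<Sum>n. cmod (c n) / (?s n)\<^sup>2 * ?K)" by (rule suminf_le[OF le sf sK])
  also have "\<dots> = (\<Sum>n. cmod (c n) / (?s n)\<^sup>2) * ?K" by (rule suminf_mult2[OF c, symmetric])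
  finally have "norm (\<Sum>n. ?f n) \<le> (\<Sum>n. cmod (c n) / (?s n)\<^sup>2) * ?K" .
  then show ?thesis unfolding coupling_function_def
    by (intro order_trans[OF norm_triangle_ineq add_left_mono])
qed

text \<open>
  On |w| = j + 1/2 the modulus of sin (\<pi> w) is at most exp (\<pi> |w|), and the denominator
  \<pi> w has modulus at least 1.
\<close>
lemma sinc_sqrt_bound:
  assumes "cmod z = (real j + 1/2)\<^sup>2"
  shows "cmod (sinc_sqrt z) \<le> exp (pi * (real j + 1/2))"
proof -
  define w where "w = csqrt z"
  have w: "z = w\<^sup>2" by (simp add: w_def)
  have cw: "cmod w = real j + 1/2"
    using assms unfolding w norm_power by (simp add: power2_eq_iff_nonneg)
  have "cmod (sinc_sqrt z) * (pi * (real j + 1/2)) = cmod (sin (of_real pi * w))"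
    unfolding sinc_sqrt_square[symmetric] w by (simp add: norm_mult cw)
  also have "\<dots> \<le> exp \<bar>Im (of_real pi * w)\<bar>"
    using cmod_sin_le_exp[of 1 "of_real pi * w"] by simp
  also have "\<dots> \<le> exp (pi * (real j + 1/2))"
  proof -
    have "\<bar>Im (of_real pi * w)\<bar> \<le> cmod (of_real pi * w)" by (rule abs_Im_le_cmod)
    then show ?thesis by (simp add: norm_mult cw)
  qed
  finally have "cmod (sinc_sqrt z) * (pi * (real j + 1/2)) \<le> exp (pi * (real j + 1/2))" .
  moreover have "2 * (1/2) \<le> pi * (real j + 1/2)"
    using pi_ge_two by (intro mult_mono) auto
  then have "cmod (sinc_sqrt z) * 1 \<le> cmod (sinc_sqrt z) * (pi * (real j + 1/2))"
    by (intro mult_left_mono) auto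
  ultimately show ?thesis by linarith
qed

text \<open>
  Let T be the deleted square.  The zero-free entire function H = G * \<Phi> with G z =
  sinc_sqrt z / (z - T) has small growth, so it is constant; its values at the remaining squares
  s k force |c k| = 2 |H 0| s k |s k - T|, which contradicts the summability of |c k| / (s k)^2.
\<close>
lemma squares_minus_one_not_removable:
  assumes w: "\<And>n. w n > 0"
  shows "\<not> removable (omit_term m (\<lambda>n. (real (Suc n))\<^sup>2)) w"
proof
  define i where "i k = (if k < m then k else Suc k)" for k
  define s where "s k = (real (Suc (i k)))\<^sup>2" for k
  have omit: "omit_term m (\<lambda>n. (real (Suc n))\<^sup>2) = s"
    by (auto simp: omit_term_def s_def i_def)
  assume "removable (omit_term m (\<lambda>n. (real (Suc n))\<^sup>2)) w"
  then have rem: "removable s w" by (simp only: omit)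
  have inj_i: "inj i" by (auto simp: inj_def i_def split: if_splits)
  have i_ne: "i k \<noteq> m" for k by (auto simp: i_def)
  have i_surj: "n \<in> range i" if "n \<noteq> m" for n
  proof (cases "n < m")
    case True then have "n = i n" by (simp add: i_def) then show ?thesis by blast
  next
    case False then have "n = i (n - 1)" using that by (auto simp: i_def) then show ?thesis by blast
  qed
  have i_ge: "i k \<ge> k" for k by (auto simp: i_def)
  have s_lim: "filterlim s at_top sequentially"
  proof (rule filterlim_at_top_mono)
    show "filterlim (\<lambda>k. (real (Suc k))\<^sup>2) at_top sequentially" by real_asymp
    show "eventually (\<lambda>k. (real (Suc k))\<^sup>2 \<le> s k) sequentially"
      unfolding s_def using i_ge by (intro always_eventually allI power_mono) auto
  qed
  have s_pos: "s k > 0" for k by (simp add: s_def)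
  have spec: "spectral_sequence s"
  proof -
    have "inj s" using inj_i by (auto simp: s_def inj_def power2_eq_iff_nonneg)
    moreover have "filterlim (\<lambda>k. \<bar>s k\<bar>) at_top sequentially" using s_lim s_pos by (simp add: less_imp_le)
    ultimately show ?thesis using s_pos by (auto simp: spectral_sequence_def less_le)
  qed
  obtain c \<kappa> where c0: "\<And>n. c n \<noteq> 0" and csum: "summable (\<lambda>n. cmod (c n) / (s n)\<^sup>2)"
    and nz: "\<And>z. z \<notin> range (\<lambda>n. complex_of_real (s n)) \<Longrightarrow> coupling_function s c \<kappa> z \<noteq> 0"
    using removable_imp_coupling[OF spec w rem] by blast

  define T where "T = complex_of_real ((real (Suc m))\<^sup>2)"
  have T: "T = (of_nat (Suc m))\<^sup>2" by (simp add: T_def)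
  have cT: "cmod T = (real (Suc m))\<^sup>2" unfolding T_def norm_of_real abs_power2 ..
  have FT: "sinc_sqrt T = 0" unfolding T sinc_sqrt_eq_0_iff by blast
  have s_cx: "complex_of_real (s k) = (of_nat (Suc (i k)))\<^sup>2" for k by (simp add: s_def)
  have Fs: "sinc_sqrt (of_real (s k)) = 0" for k unfolding s_cx sinc_sqrt_eq_0_iff by blast
  have sT: "complex_of_real (s k) \<noteq> T" for k
    using i_ne[of k] by (auto simp: s_def T_def power2_eq_iff_nonneg simp flip: of_real_power simp del: of_nat_Suc of_real_power)
  define G where "G z = (if z = T then deriv sinc_sqrt T else (sinc_sqrt z - sinc_sqrt T) / (z - T))" for z
  have G_hol: "G holomorphic_on UNIV"
    unfolding G_def[abs_def] by (rule pole_lemma_open[OF sinc_sqrt_holomorphic open_UNIV])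
  have GF: "sinc_sqrt z = G z * (z - T)" for z by (auto simp: G_def FT)
  have Gs: "G (of_real (s k)) = 0" for k using GF[of "of_real (s k)"] Fs sT by simp
  have G_nz: "G z \<noteq> 0" if "z \<notin> range (\<lambda>n. complex_of_real (s n))" for z
  proof (cases "z = T")
    case True
    have "cmod (deriv sinc_sqrt T) = 1 / (2 * (real (Suc m))\<^sup>2)" unfolding T by (rule cmod_deriv_sinc_sqrt)
    then have "deriv sinc_sqrt T \<noteq> 0" by (auto simp del: of_nat_Suc)
    then show ?thesis using True by (simp add: G_def)
  next
    case False
    show ?thesis
    proof
      assume "G z = 0"
      then have "sinc_sqrt z = 0" using GF[of z] by simp
      then obtain n where n: "z = (of_nat (Suc n))\<^sup>2" unfolding sinc_sqrt_eq_0_iff by blast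
      then have "n \<noteq> m" using False T by blast
      then obtain k where "n = i k" using i_surj by blast
      then have "z = of_real (s k)" using n s_cx by simp
      then show False using that by blast
    qed
  qed
  have G'_norm: "1 = cmod (deriv G (of_real (s k))) * (cmod (of_real (s k) - T) * (2 * s k))" for k
  proof -
    let ?z = "complex_of_real (s k)"
    have "(G has_field_derivative deriv G ?z) (at ?z)" using G_hol by (simp add: holomorphic_derivI)
    moreover have "((\<lambda>z. z - T) has_field_derivative 1) (at ?z)" by (auto intro!: derivative_eq_intros)
    ultimately have "((\<lambda>z. G z * (z - T)) has_field_derivative deriv G ?z * (?z - T) + 1 * G ?z) (at ?z)"
      by (rule DERIV_mult)
    then have "(sinc_sqrt has_field_derivative deriv G ?z * (?z - T)) (at ?z)"
      unfolding GF[symmetric] Gs by simp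
    then have "deriv sinc_sqrt ?z = deriv G ?z * (?z - T)" by (rule DERIV_imp_deriv)
    moreover have "cmod (deriv sinc_sqrt ?z) = 1 / (2 * s k)"
      unfolding s_cx cmod_deriv_sinc_sqrt by (simp add: s_def)
    ultimately have "cmod (deriv G ?z) * cmod (?z - T) = 1 / (2 * s k)" by (metis norm_mult)
    then show ?thesis using s_pos[of k] by (simp add: field_simps)
  qed

  obtain H where H_hol: "H holomorphic_on UNIV"
    and H_off: "\<And>z. z \<notin> range (\<lambda>n. complex_of_real (s n)) \<Longrightarrow> H z = G z * coupling_function s c \<kappa> z"
    and H_on: "\<And>k. H (of_real (s k)) = - c k * deriv G (of_real (s k))"
    using entire_multiple_of_coupling_function[OF spec csum G_hol Gs] by metis
  have H_nz: "H z \<noteq> 0" for z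
  proof (cases "z \<in> range (\<lambda>n. complex_of_real (s n))")
    case True
    then obtain k where k: "z = of_real (s k)" by blast
    have "deriv G (of_real (s k)) \<noteq> 0" using G'_norm[of k] by auto
    then show ?thesis using c0[of k] by (simp add: k H_on)
  next
    case False
    then show ?thesis using G_nz nz by (simp add: H_off)
  qed
  define S where "S = (\<Sum>n. cmod (c n) / (s n)\<^sup>2) + 1"
  define K where "K = cmod \<kappa> + 1"
  have "S > 0" unfolding S_def using csum by (intro add_nonneg_pos suminf_nonneg) auto
  have "K > 0" by (simp add: K_def add_nonneg_pos)
  define r where "r j = (real j + 1/2)\<^sup>2" for j :: nat
  \<comment> \<open>The logarithm of the product of the bounds on G and on the coupling function when |z| = r j.\<close>
  define g where "g j = pi * (real j + 1/2) + ln (4 * (K + S * ((real j + 1/2)\<^sup>2 * (2 * real j + 2))))" for j :: nat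
  have const: "H z = H 0" for z
  proof (rule zero_free_entire_small_growth_constant[OF H_hol H_nz, of r g])
    show "filterlim r at_top sequentially" unfolding r_def by real_asymp
    show "(\<lambda>j. g j / r j) \<longlonglongrightarrow> 0" unfolding g_def r_def using \<open>S > 0\<close> \<open>K > 0\<close> by real_asymp
  next
    fix j z assume "cmod z = r j"
    then have z: "cmod z = (real j + 1/2)\<^sup>2" by (simp add: r_def)
    let ?Q = "K + S * ((real j + 1/2)\<^sup>2 * (2 * real j + 2))"
    have "?Q > 0" using \<open>S > 0\<close> \<open>K > 0\<close> by (intro add_pos_nonneg) auto
    have "z \<noteq> of_real (s k)" for k
      using square_distance(1)[OF z, of "Suc (i k)"] by (auto simp: s_def)
    then have off: "z \<notin> range (\<lambda>n. complex_of_real (s n))" by auto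
    have "cmod (z - T) \<ge> 1/4"
      using square_distance(1)[OF z, of "Suc m"] by (simp add: T_def norm_minus_commute)
    then have "cmod (G z) * (1/4) \<le> cmod (G z) * cmod (z - T)" by (intro mult_left_mono) auto
    also have "\<dots> = cmod (sinc_sqrt z)" unfolding GF norm_mult ..
    also have "\<dots> \<le> exp (pi * (real j + 1/2))" by (rule sinc_sqrt_bound[OF z])
    finally have Gz: "cmod (G z) \<le> 4 * exp (pi * (real j + 1/2))" by simp
    have "cmod (coupling_function s c \<kappa> z) \<le>
      cmod \<kappa> + (\<Sum>n. cmod (c n) / (s n)\<^sup>2) * ((real j + 1/2)\<^sup>2 * (2 * real j + 2))"
      using coupling_function_bound[of c "\<lambda>n. Suc (i n)", OF csum[unfolded s_def] _ z] unfolding s_def by simp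
    also have "\<dots> \<le> ?Q" unfolding K_def S_def by (intro add_mono mult_right_mono) auto
    finally have "cmod (H z) \<le> 4 * exp (pi * (real j + 1/2)) * ?Q"
      unfolding H_off[OF off] norm_mult using Gz by (intro mult_mono) auto
    also have "\<dots> = exp (g j)" using \<open>?Q > 0\<close> by (simp add: g_def exp_add)
    finally show "cmod (H z) \<le> exp (g j)" .
  qed
  have "cmod (c k) = cmod (H 0) * (cmod (of_real (s k) - T) * (2 * s k))" for k
  proof -
    have "H 0 = - c k * deriv G (of_real (s k))" using const[of "of_real (s k)"] H_on[of k] by metis
    then have "cmod (H 0) = cmod (c k) * cmod (deriv G (of_real (s k)))" by (simp only: norm_mult norm_minus_cancel)
    then show ?thesis using G'_norm[of k] by simp
  qed
  then have ratio: "cmod (c k) / (s k)\<^sup>2 = 2 * cmod (H 0) * (cmod (of_real (s k) - T) / s k)" for k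
    using s_pos[of k] by (simp add: power2_eq_square)
  have "eventually (\<lambda>k. 2 * (real (Suc m))\<^sup>2 \<le> s k) sequentially"
    using s_lim by (simp add: filterlim_at_top)
  then have "eventually (\<lambda>k. cmod (H 0) \<le> cmod (c k) / (s k)\<^sup>2) sequentially"
  proof eventually_elim
    case (elim k)
    have "s k - (real (Suc m))\<^sup>2 \<le> cmod (of_real (s k) - T)"
      using norm_triangle_ineq2[of "complex_of_real (s k)" T] s_pos[of k] unfolding cT norm_of_real by simp
    then have "1/2 \<le> cmod (of_real (s k) - T) / s k"
      using elim s_pos[of k] by (simp add: le_divide_eq)
    then have "2 * cmod (H 0) * (1/2) \<le> 2 * cmod (H 0) * (cmod (of_real (s k) - T) / s k)"
      by (intro mult_left_mono) auto
    then show ?case unfolding ratio by simp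
  qed
  then have "cmod (H 0) \<le> 0"
    by (intro tendsto_lowerbound[OF summable_LIMSEQ_zero[OF csum]]) auto
  then show False using H_nz[of 0] by simp
qed

theorem corollary5p3:
  shows "\<exists>t :: nat \<Rightarrow> real. spectral_sequence t \<and>
    (\<forall>w. (\<forall>n. w n > 0) \<longrightarrow> removable t w) \<and>
    (\<forall>m w. (\<forall>n. w n > 0) \<longrightarrow> \<not> removable (omit_term m t) w)"
  using spectral_sequence_squares squares_removable squares_minus_one_not_removable
  by (intro exI[of _ "\<lambda>n. (real (Suc n))\<^sup>2"]) blast

end
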